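(* Let $d$ be a positive integer, $\epsilon>0$, and let $p^0\in\mathbb{R}^d_{>0}$ be a probability vector. For each $n$ let $X_1,\dots,X_n$ be i.i.d. $\mathrm{Multinomial}(1,p)$ and let $\tilde H=\sum_{i=1}^n\mathcal{M}_{\mathrm{bit}}(X_i,\epsilon)$, where the mechanism is applied with independent randomness to each entry. Let $\alpha_\epsilon=\frac{e^{\epsilon/2}-1}{e^{\epsilon/2}+1}$, $\tilde p^0=\frac{(e^{\epsilon/2}-1)p^0+\mathbf{1}}{e^{\epsilon/2}+1}$, $\Pi=I_d-\frac1d\mathbf{1}\mathbf{1}^\top$, $$\Sigma(p^0)=\alpha_\epsilon^2\left[\mathrm{Diag}(p^0)-p^0(p^0)^\top\right]+\frac{e^{\epsilon/2}}{(e^{\epsilon/2}+1)^2}I_d,$$ and $$T^{(n)}_{\mathrm{BitFlip}}(\epsilon)=n\left(\frac{\tilde H}{n}-\tilde p^0\right)^\top\Pi\,\Sigma(p^0)^{-1}\,\Pi\left(\frac{\tilde H}{n}-\tilde p^0\right).$$ (i) Under the null hypothesis $p=p^0$, $T^{(n)}_{\mathrm{BitFlip}}(\epsilon)\xrightarrow{D}\chi^2_{d-1}$ as $n\to\infty$. (ii) Let $\Delta\in\mathbb{R}^d$ be fixed with $\mathbf{1}^\top\Delta=0$. Under the alternate hypothesis $p=p^1_n:=p^0+\frac{\Delta}{\sqrt n}$, $$T^{(n)}_{\mathrm{BitFlip}}(\epsilon)\xrightarrow{D}\chi^2_{d-1}\left(\left(\frac{e^{\epsilon/2}-1}{e^{\epsilon/2}+1}\right)^2\Delta^\top\Sigma(p^0)^{-1}\Delta\right)\quad\text{as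 } n\to\infty.$$
   Context: $e_1,\dots,e_d$ is the standard basis of $\mathbb{R}^d$ and $\mathbf{1}$ is the all-ones vector. A $\mathrm{Multinomial}(1,p)$ variable equals $e_j$ with probability $p_j$. The mechanism $\mathcal{M}_{\mathrm{bit}}(x,\epsilon)$ takes $x\in\{e_1,\dots,e_d\}$ and outputs $z\in\{0,1\}^d$ where, independently for each $j$, $z_j=x_j$ with probability $\frac{e^{\epsilon/2}}{e^{\epsilon/2}+1}$ and $z_j=1-x_j$ otherwise. $\chi^2_\nu(\lambda)$ denotes the noncentral chi-square distribution with $\nu$ degrees of freedom and noncentrality parameter $\lambda$, i.e. the law of $\|N(\mu,I_\nu)\|^2$ with $\|\mu\|^2=\lambda$; $\chi^2_\nu=\chi^2_\nu(0)$. $\xrightarrow{D}$ is convergence in distribution. In (ii), the data for each $n$ (large enough that $p_n^1$ has positive entries) are drawn from $p^1_n$. *)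

theory Defs
  imports "HOL-Probability.Probability"
begin

text \<open>
  \<^const>\<open>embed_pmf\<close> is only specified for probability vectors \<open>p\<close>;
  for any other \<open>p\<close> the value is an unspecified distribution.
\<close>

definition multinomial1_pmf :: "real ^ 'd \<Rightarrow> (real ^ 'd) pmf" where
  "multinomial1_pmf p = map_pmf (\<lambda>j. axis j 1) (embed_pmf (\<lambda>j. p $ j))"

definition bit_flip_pmf :: "real ^ 'd \<Rightarrow> real \<Rightarrow> (real ^ 'd) pmf" where
  "bit_flip_pmf x \<epsilon> =
     map_pmf (\<lambda>z. \<chi> j. z j)
       (Pi_pmf UNIV 0 (\<lambda>j.
          map_pmf (\<lambda>keep. if keep then x $ j else 1 - x $ j)
            (bernoulli_pmf (exp (\<epsilon> / 2) / (exp (\<epsilon> / 2) + 1)))))"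

definition private_histogram_pmf :: "nat \<Rightarrow> real ^ 'd \<Rightarrow> real \<Rightarrow> (real ^ 'd) pmf" where
  "private_histogram_pmf n p \<epsilon> =
     bind_pmf (Pi_pmf {1..n} 0 (\<lambda>i. multinomial1_pmf p)) (\<lambda>X.
     bind_pmf (Pi_pmf {1..n} 0 (\<lambda>i. bit_flip_pmf (X i) \<epsilon>)) (\<lambda>Z.
     return_pmf (\<Sum>i\<in>{1..n}. Z i)))"

definition alpha_eps :: "real \<Rightarrow> real" where
  "alpha_eps \<epsilon> = (exp (\<epsilon> / 2) - 1) / (exp (\<epsilon> / 2) + 1)"

definition p_tilde :: "real \<Rightarrow> real ^ 'd \<Rightarrow> real ^ 'd" where
  "p_tilde \<epsilon> p = (\<chi> j. ((exp (\<epsilon> / 2) - 1) * p $ j + 1) / (exp (\<epsilon> / 2) + 1))"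

definition diag_matrix :: "real ^ 'd \<Rightarrow> real ^ 'd ^ 'd" where
  "diag_matrix p = (\<chi> i j. if i = j then p $ i else 0)"

definition outer_product :: "real ^ 'd \<Rightarrow> real ^ 'd \<Rightarrow> real ^ 'd ^ 'd" where
  "outer_product u v = (\<chi> i j. u $ i * v $ j)"

definition centering_matrix :: "real ^ 'd ^ 'd" where
  "centering_matrix = mat 1 - (1 / real CARD('d)) *\<^sub>R outer_product 1 1"

definition Sigma_bit :: "real \<Rightarrow> real ^ 'd \<Rightarrow> real ^ 'd ^ 'd" where
  "Sigma_bit \<epsilon> p =
     (alpha_eps \<epsilon>)\<^sup>2 *\<^sub>R (diag_matrix p - outer_product p p)
     + (exp (\<epsilon> / 2) / (exp (\<epsilon> / 2) + 1)\<^sup>2) *\<^sub>R mat 1"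

definition T_BitFlip :: "nat \<Rightarrow> real \<Rightarrow> real ^ 'd \<Rightarrow> real ^ 'd \<Rightarrow> real" where
  "T_BitFlip n \<epsilon> p0 H =
     (let v = (1 / real n) *\<^sub>R H - p_tilde \<epsilon> p0
      in real n *
         (v \<bullet> ((centering_matrix ** matrix_inv (Sigma_bit \<epsilon> p0) ** centering_matrix) *v v)))"

text \<open>The law of the statistic for the null vector \<open>p0\<close> when the data are drawn from \<open>p\<close>.\<close>

definition T_BitFlip_law :: "nat \<Rightarrow> real \<Rightarrow> real ^ 'd \<Rightarrow> real ^ 'd \<Rightarrow> real measure" where
  "T_BitFlip_law n \<epsilon> p0 p =
     distr (measure_pmf (private_histogram_pmf n p \<epsilon>)) borel (T_BitFlip n \<epsilon> p0)"

text \<open>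
  The law of \<open>\<parallel>N(\<mu>, I\<^sub>\<nu>)\<parallel>\<^sup>2\<close>. The dimension is a number rather than a type because the
  theorem uses \<open>\<nu> = d - 1\<close>, which may be \<open>0\<close>; the law is then the point mass at \<open>0\<close>.
\<close>

definition norm2_normal_law :: "nat \<Rightarrow> (nat \<Rightarrow> real) \<Rightarrow> real measure" where
  "norm2_normal_law \<nu> \<mu> =
     distr (PiM {..<\<nu>} (\<lambda>i. density lborel (normal_density (\<mu> i) 1))) borel
       (\<lambda>x. \<Sum>i<\<nu>. (x i)\<^sup>2)"

text \<open>
  By rotation invariance the choice of the mean vector \<open>\<mu>\<close> with \<open>\<parallel>\<mu>\<parallel>\<^sup>2 = \<lambda>\<close> is immaterial.
  Such a vector exists if \<open>\<lambda> = 0\<close>, or if \<open>\<lambda> > 0\<close> and \<open>\<nu> > 0\<close>.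
\<close>

definition noncentral_chi_square :: "nat \<Rightarrow> real \<Rightarrow> real measure" where
  "noncentral_chi_square \<nu> l =
     norm2_normal_law \<nu> (SOME \<mu>. (\<Sum>i<\<nu>. (\<mu> i)\<^sup>2) = l)"

definition chi_square :: "nat \<Rightarrow> real measure" where
  "chi_square \<nu> = noncentral_chi_square \<nu> 0"

end

theory Submission
  imports Defs
begin

text \<open>
  One output of the mechanism has covariance matrix \<open>\<Sigma>(p)\<close>, so the characteristic function of
  \<open>w = \<surd>n (H / n - p\<^sub>0')\<close>, where \<open>p\<^sub>0'\<close> is \<^term>\<open>p_tilde \<epsilon> p0\<close>, tends pointwise to that of
  \<open>N(\<alpha> \<Delta>, \<Sigma>(p0))\<close>. Since \<open>1\<close> is an eigenvector of \<open>\<Sigma>(p0)\<close>, a \<open>\<Sigma>\<close>-orthonormal basis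
  \<open>a\<^sub>1, \<dots>, a\<^sub>d\<^sub>-\<^sub>1\<close> of its orthogonal complement turns the statistic into \<open>\<Sum>\<^sub>i (a\<^sub>i \<bullet> w)\<^sup>2\<close>.

  The multivariate continuity theorem is avoided by Gaussian linearisation: for a standard normal
  vector \<open>g\<close>, \<open>exp (- k \<parallel>y\<parallel>\<^sup>2)\<close> is the mean of \<open>exp (\<i> \<surd>(2 k) (g \<bullet> y))\<close>, so pointwise convergence of
  characteristic functions gives convergence of the Laplace transforms of sums of squares. On the
  half-line, Laplace transforms at natural numbers are the moments of \<open>exp (- x) \<in> [0, 1]\<close>, and
  these determine weak convergence by the Weierstrass theorem. The closed form of the limit also
  shows that the noncentral chi-square law depends on the mean vector only through its norm.
\<close>

section \<open>Weak convergence on the half-line from Laplace transforms\<close>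

text \<open>The substitution u = exp (- x) maps the half-line into [0, 1] and turns polynomials in u
  into combinations of the given Laplace transforms. Weak convergence need only be tested on the
  functions \<open>cts_step a b\<close>, so a uniform polynomial approximation of each in u
  suffices.\<close>

lemma weak_conv_m_nonneg_Laplace:
  fixes M_seq :: "nat \<Rightarrow> real measure" and M :: "real measure"
  assumes distr: "\<And>n. real_distribution (M_seq n)" "real_distribution M"
    and nonneg: "\<And>n. AE x in M_seq n. 0 \<le> x" "AE x in M. 0 \<le> x"
    and Laplace: "\<And>k::nat. (\<lambda>n. \<integral>x. exp (- (real k * x)) \<partial>M_seq n) \<longlonglongrightarrow> (\<integral>x. exp (- (real k * x)) \<partial>M)"
  shows "weak_conv_m M_seq M"
proof (rule integral_cts_step_conv_imp_weak_conv[OF distr])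
  fix a b :: real assume "a < b"
  \<comment> \<open>This is \<open>cts_step a b\<close> in the variable u. The step vanishes beyond
    \<open>b\<close>, that is for 0 < u < exp (- b), so the value 0 for u \<le> 0 extends it
    continuously.\<close>
  define f where "f u = (if u \<le> 0 then 0 else cts_step a b (- ln u))" for u
  have f_exp: "f (exp (- x)) = cts_step a b x" for x
    by (simp add: f_def)
  have cont_pos: "continuous_on {0<..} f"
  proof -
    have "continuous_on {0<..} (\<lambda>u. cts_step a b (- ln u))"
      by (rule continuous_on_compose2[OF uniformly_continuous_imp_continuous
            [OF cts_step_uniformly_continuous[OF \<open>a < b\<close>]]])
         (auto intro!: continuous_intros)
    then show ?thesis
      by (rule continuous_on_cong[THEN iffD1, rotated 2]) (auto simp: f_def)
  qed
  have cont_small: "continuous_on {..<exp (- b)} f"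
  proof (rule continuous_on_cong[THEN iffD1, OF refl _ continuous_on_const[of _ 0]])
    fix u assume u: "u \<in> {..<exp (- b)}"
    show "0 = f u"
    proof (cases "u \<le> 0")
      case False
      then have "ln u < - b"
        using u by (metis exp_less_cancel_iff exp_ln lessThan_iff not_le)
      then show ?thesis
        using \<open>a < b\<close> False by (auto simp: f_def cts_step_def)
    qed (simp add: f_def)
  qed
  have cont: "continuous_on UNIV f"
  proof -
    have "continuous_on ({0<..} \<union> {..<exp (- b)}) f"
      by (rule continuous_on_open_Un[OF _ _ cont_pos cont_small]) auto
    moreover have "{0<..} \<union> {..<exp (- b)} = UNIV"
      by (auto, metis exp_gt_zero le_less_trans not_le)
    ultimately show ?thesis by simp
  qed
  show "(\<lambda>n. integral\<^sup>L (M_seq n) (cts_step a b)) \<longlonglongrightarrow> integral\<^sup>L M (cts_step a b)"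
  proof (rule LIMSEQ_I)
    fix r :: real assume "r > 0"
    then have "r / 3 > 0" by simp
    obtain g where g: "real_polynomial_function g"
      and fg: "\<And>u. u \<in> {0..1} \<Longrightarrow> \<bar>f u - g u\<bar> < r / 3"
      using Stone_Weierstrass_real_polynomial_function[OF compact_Icc
          continuous_on_subset[OF cont subset_UNIV] \<open>r / 3 > 0\<close>, of 0 1] by blast
    obtain c m where c: "g = (\<lambda>u. \<Sum>i\<le>m. c i * u ^ i)"
      using g unfolding real_polynomial_function_iff_sum by blast
    define P where "P x = (\<Sum>i\<le>m. c i * exp (- (real i * x)))" for x
    have P: "P x = g (exp (- x))" for x
      unfolding P_def c by (simp add: exp_of_nat_mult[symmetric])
    have int_exp: "integrable N (\<lambda>x. exp (- (real k * x)))"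
      if "real_distribution N" "AE x in N. 0 \<le> x" for N :: "real measure" and k :: nat
    proof -
      interpret N: real_distribution N by fact
      show ?thesis
        by (rule N.integrable_const_bound[of _ 1]) (use that(2) in \<open>auto elim: eventually_mono\<close>)
    qed
    have int_P: "integrable N P" 
      "integral\<^sup>L N P = (\<Sum>i\<le>m. c i * (\<integral>x. exp (- (real i * x)) \<partial>N))"
      if "real_distribution N" "AE x in N. 0 \<le> x" for N :: "real measure"
      unfolding P_def using int_exp[OF that] by (auto simp: Bochner_Integration.integral_sum)
    \<comment> \<open>The bound is uniform over all laws on the half-line: nonnegativity of x keeps
      exp (- x) in [0, 1], where \<open>g\<close> approximates \<open>f\<close>.\<close>
    have close: "\<bar>integral\<^sup>L N (cts_step a b) - integral\<^sup>L N P\<bar> \<le> r / 3"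
      if N: "real_distribution N" "AE x in N. 0 \<le> x" for N :: "real measure"
    proof -
      interpret N: real_distribution N by fact
      have int: "integrable N (cts_step a b)" by (rule N.integrable_cts_step[OF \<open>a < b\<close>])
      have "\<bar>integral\<^sup>L N (cts_step a b) - integral\<^sup>L N P\<bar> = \<bar>\<integral>x. cts_step a b x - P x \<partial>N\<bar>"
        using int int_P(1)[OF N] by simp
      also have "\<dots> \<le> (\<integral>x. \<bar>cts_step a b x - P x\<bar> \<partial>N)"
        by (rule integral_abs_bound)
      also have "\<dots> \<le> (\<integral>x. r / 3 \<partial>N)"
      proof (rule integral_mono_AE)
        show "AE x in N. \<bar>cts_step a b x - P x\<bar> \<le> r / 3"
          using N(2)
        proof eventually_elim
          case (elim x)
          then show ?case
            using fg[of "exp (- x)"] by (simp add: f_exp P)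
        qed
      qed (use int int_P(1)[OF N] in auto)
      also have "\<dots> = r / 3" using N.prob_space by simp
      finally show ?thesis .
    qed
    have "(\<lambda>n. integral\<^sup>L (M_seq n) P) \<longlonglongrightarrow> integral\<^sup>L M P"
      using int_P(2)[OF distr(1) nonneg(1)] int_P(2)[OF distr(2) nonneg(2)]
      by (simp only:) (intro tendsto_intros Laplace)
    then obtain n0 where n0: "\<And>n. n \<ge> n0 \<Longrightarrow> \<bar>integral\<^sup>L (M_seq n) P - integral\<^sup>L M P\<bar> < r / 3"
      using \<open>r / 3 > 0\<close> by (metis LIMSEQ_D real_norm_def)
    show "\<exists>n0. \<forall>n\<ge>n0. norm (integral\<^sup>L (M_seq n) (cts_step a b) - integral\<^sup>L M (cts_step a b)) < r"
    proof (intro exI[of _ n0] allI impI)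
      fix n assume "n0 \<le> n"
      from n0[OF this] close[OF distr(1) nonneg(1), of n] close[OF distr(2) nonneg(2)]
      show "norm (integral\<^sup>L (M_seq n) (cts_step a b) - integral\<^sup>L M (cts_step a b)) < r"
        unfolding real_norm_def by linarith
    qed
  qed
qed

section \<open>Gaussian linearisation of sums of squares\<close>

text \<open>Complete the square: up to a constant, the density times exp (- s x^2) is the normal
  density with mean m / v and variance 1 / v, where v = 1 + 2 s.\<close>

lemma integral_normal_exp_square:
  assumes "0 \<le> s"
  shows "(\<integral>x. exp (- (s * x\<^sup>2)) \<partial>density lborel (normal_density m 1)) =
    exp (- (s * m\<^sup>2 / (1 + 2 * s))) / sqrt (1 + 2 * s)"
proof -
  define v where "v = 1 + 2 * s"
  have v: "v > 0" "1 + 2 * s = v" "s = (v - 1) / 2" using assms by (auto simp: v_def)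
  have eq: "normal_density m 1 x * exp (- (s * x\<^sup>2)) =
     exp (- (s * m\<^sup>2 / v)) / sqrt v * normal_density (m / v) (1 / sqrt v) x" for x
  proof -
    have e: "- (x - m)\<^sup>2 / 2 + - (s * x\<^sup>2) = - (s * m\<^sup>2 / v) + - (x - m / v)\<^sup>2 / (2 * (1 / sqrt v)\<^sup>2)"
      using v(1) unfolding v(3) by (simp add: power_divide field_simps power2_eq_square)
    have "normal_density m 1 x * exp (- (s * x\<^sup>2)) 
       = 1 / sqrt (2 * pi) * exp (- (x - m)\<^sup>2 / 2 + - (s * x\<^sup>2))"
      unfolding normal_density_def exp_add by simp
    also have "\<dots> = exp (- (s * m\<^sup>2 / v)) / sqrt v * normal_density (m / v) (1 / sqrt v) x"
      unfolding e exp_add normal_density_def using v(1)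
      by (simp add: power_divide real_sqrt_divide real_sqrt_mult)
    finally show ?thesis .
  qed
  have "(\<integral>x. exp (- (s * x\<^sup>2)) \<partial>density lborel (normal_density m 1)) =
     (\<integral>x. normal_density m 1 x * exp (- (s * x\<^sup>2)) \<partial>lborel)"
    by (subst integral_density) auto
  also have "\<dots> = exp (- (s * m\<^sup>2 / v)) / sqrt v"
    unfolding eq using v(1) by simp
  finally show ?thesis by (simp only: v(2))
qed

lemma CLINT_std_normal_iexp: "(CLINT x|density lborel std_normal_density. iexp (t * x)) = exp (- (t\<^sup>2) / 2)"
  using char_std_normal_distribution unfolding char_def fun_eq_iff by simp

text \<open>The integrand is the characteristic function of N(m, 1) at the random frequency c x.
  With v = 1 + c^2, rescaling x to x / sqrt v absorbs the quadratic exponent into the standard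
  density, which leaves a characteristic function at c m / sqrt v.\<close>

lemma CLINT_normal_iexp_exp_square:
  "(CLINT x|density lborel std_normal_density. iexp (c * m * x) * exp (- (c\<^sup>2 * x\<^sup>2 / 2))) =
    exp (- (c\<^sup>2 * m\<^sup>2 / 2 / (1 + c\<^sup>2))) / sqrt (1 + c\<^sup>2)"
proof -
  define v where "v = 1 + c\<^sup>2"
  have v: "v > 0" "v \<noteq> 0" unfolding v_def using zero_le_power2[of c] by linarith+
  have d: "std_normal_density (x / sqrt v) * exp (- (c\<^sup>2 * (x / sqrt v)\<^sup>2 / 2)) = std_normal_density x" for x
  proof -
    have sq: "v * (x / sqrt v)\<^sup>2 = x\<^sup>2"
      using v by (simp add: power_divide)
    have "- q / 2 + - (c\<^sup>2 * q / 2) = - (v * q) / 2" for q :: real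
      unfolding v_def by (simp add: distrib_right)
    from this[of "(x / sqrt v)\<^sup>2"]
    have e: "- (x / sqrt v)\<^sup>2 / 2 + - (c\<^sup>2 * (x / sqrt v)\<^sup>2 / 2) = - x\<^sup>2 / 2"
      unfolding sq .
    show ?thesis unfolding std_normal_density_def e[symmetric] exp_add by simp
  qed
  have "(CLINT x|density lborel std_normal_density. iexp (c * m * x) * exp (- (c\<^sup>2 * x\<^sup>2 / 2)))
    = (CLINT x|lborel. std_normal_density x *\<^sub>R (iexp (c * m * x) * exp (- (c\<^sup>2 * x\<^sup>2 / 2))))"
    by (subst integral_density) auto
  also have "\<dots> = \<bar>1 / sqrt v\<bar> *\<^sub>R (CLINT x|lborel. std_normal_density (0 + 1 / sqrt v * x) *\<^sub>R
      (iexp (c * m * (0 + 1 / sqrt v * x)) * exp (- (c\<^sup>2 * (0 + 1 / sqrt v * x)\<^sup>2 / 2))))"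
    by (rule lborel_integral_real_affine) (use v in auto)
  also have "(\<lambda>x. std_normal_density (0 + 1 / sqrt v * x) *\<^sub>R
      (iexp (c * m * (0 + 1 / sqrt v * x)) * exp (- (c\<^sup>2 * (0 + 1 / sqrt v * x)\<^sup>2 / 2))))
    = (\<lambda>x. std_normal_density x *\<^sub>R iexp (c * m / sqrt v * x))"
  proof
    fix x
    show "std_normal_density (0 + 1 / sqrt v * x) *\<^sub>R
      (iexp (c * m * (0 + 1 / sqrt v * x)) * exp (- (c\<^sup>2 * (0 + 1 / sqrt v * x)\<^sup>2 / 2)))
      = std_normal_density x *\<^sub>R iexp (c * m / sqrt v * x)"
      unfolding d[of x, symmetric] by (simp add: scaleR_conv_of_real exp_of_real[symmetric])
  qed
  also have "(CLINT x|lborel. std_normal_density x *\<^sub>R iexp (c * m / sqrt v * x)) =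
     (CLINT x|density lborel std_normal_density. iexp (c * m / sqrt v * x))"
    by (subst integral_density) auto
  also have "\<dots> = exp (- ((c * m / sqrt v)\<^sup>2) / 2)"
    by (rule CLINT_std_normal_iexp)
  also have "(c * m / sqrt v)\<^sup>2 = c\<^sup>2 * m\<^sup>2 / v"
    using v by (simp add: power_divide power_mult_distrib)
  finally show ?thesis
    using v by (simp add: v_def[symmetric] scaleR_conv_of_real)
qed

lemma product_prob_space_normal:
  "product_prob_space (\<lambda>i. density lborel (normal_density (\<mu> i) 1))"
  by (intro product_prob_spaceI prob_space_normal_density) simp

lemma real_distribution_norm2_normal_law: "real_distribution (norm2_normal_law \<nu> \<mu>)"
proof -
  interpret product_prob_space "\<lambda>i. density lborel (normal_density (\<mu> i) 1)"
    by (rule product_prob_space_normal)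
  interpret PP: prob_space "PiM {..<\<nu>} (\<lambda>i. density lborel (normal_density (\<mu> i) 1))"
    by (rule prob_space_PiM[OF M.prob_space_axioms])
  show ?thesis
    unfolding norm2_normal_law_def by (rule PP.real_distribution_distr) measurable
qed

lemma AE_norm2_normal_law_nonneg: "AE x in norm2_normal_law \<nu> \<mu>. 0 \<le> x"
  unfolding norm2_normal_law_def by (subst AE_distr_iff) (auto intro!: sum_nonneg)

text \<open>Independence of the coordinates factors the transform. The mean vector enters the result
  only through its squared norm, so its choice is immaterial later on.\<close>

lemma Laplace_norm2_normal_law:
  assumes "0 \<le> s"
  shows "(\<integral>x. exp (- (s * x)) \<partial>norm2_normal_law \<nu> \<mu>) =
    exp (- (s * (\<Sum>i<\<nu>. (\<mu> i)\<^sup>2) / (1 + 2 * s))) / sqrt (1 + 2 * s) ^ \<nu>"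
proof -
  let ?N = "\<lambda>i. density lborel (normal_density (\<mu> i) 1)"
  interpret product_prob_space ?N by (rule product_prob_space_normal)
  have "(\<integral>x. exp (- (s * x)) \<partial>norm2_normal_law \<nu> \<mu>) =
      (\<integral>x. (\<Prod>i<\<nu>. exp (- (s * (x i)\<^sup>2))) \<partial>PiM {..<\<nu>} ?N)"
    unfolding norm2_normal_law_def
    by (subst integral_distr) (auto simp: exp_sum[symmetric] sum_distrib_left sum_negf)
  also have "\<dots> = (\<Prod>i<\<nu>. \<integral>x. exp (- (s * x\<^sup>2)) \<partial>?N i)"
  proof (rule product_integral_prod)
    fix i
    show "integrable (?N i) (\<lambda>x. exp (- (s * x\<^sup>2)))"
      by (rule M.integrable_const_bound[of _ 1]) (use assms in auto)
  qed simp
  also have "\<dots> = exp (- (s * (\<Sum>i<\<nu>. (\<mu> i)\<^sup>2) / (1 + 2 * s))) / sqrt (1 + 2 * s) ^ \<nu>"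
    by (simp add: integral_normal_exp_square[OF assms] prod_dividef exp_sum[symmetric]
        sum_negf sum_distrib_left sum_divide_distrib)
  finally show ?thesis .
qed

lemma iexp_sum: "finite A \<Longrightarrow> iexp (\<Sum>i\<in>A. f i) = (\<Prod>i\<in>A. iexp (f i))"
  by (simp add: sum_distrib_left exp_sum)

text \<open>Read from right to left this is the linearisation: a Gaussian function of
  \<open>y\<close> becomes an average of exponentials whose exponents are linear in
  \<open>y\<close>.\<close>

lemma CLINT_PiM_std_normal_iexp:
  fixes y :: "nat \<Rightarrow> real"
  shows "(CLINT g|PiM {..<\<nu>} (\<lambda>i. density lborel std_normal_density). iexp (\<Sum>i<\<nu>. g i * y i)) =
    exp (- (\<Sum>i<\<nu>. (y i)\<^sup>2) / 2)"
proof -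
  interpret product_prob_space "\<lambda>i. density lborel std_normal_density"
    using product_prob_space_normal[of "\<lambda>_. 0"] by simp
  have "(CLINT g|PiM {..<\<nu>} (\<lambda>i. density lborel std_normal_density). iexp (\<Sum>i<\<nu>. g i * y i)) =
      (CLINT g|PiM {..<\<nu>} (\<lambda>i. density lborel std_normal_density). (\<Prod>i<\<nu>. iexp (y i * g i)))"
    by (simp only: iexp_sum finite_lessThan mult.commute)
  also have "\<dots> = (\<Prod>i<\<nu>. CLINT x|density lborel std_normal_density. iexp (y i * x))"
    by (rule product_integral_prod) (auto intro!: M.integrable_const_bound[of _ 1])
  also have "\<dots> = exp (- (\<Sum>i<\<nu>. (y i)\<^sup>2) / 2)"
    unfolding CLINT_std_normal_iexp
    by (simp only: of_real_prod[symmetric] exp_sum[symmetric] finite_lessThan sum_negf[symmetric] sum_divide_distrib)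
  finally show ?thesis .
qed

text \<open>Averages the characteristic function of N(m, I) over Gaussian frequencies
  \<open>c * g\<close>, one coordinate at a time. The value is the Laplace transform of the squared
  norm of N(m, I) at c^2 / 2.\<close>

lemma CLINT_PiM_std_normal_iexp_exp_square:
  fixes m :: "nat \<Rightarrow> real"
  shows "(CLINT g|PiM {..<\<nu>} (\<lambda>i. density lborel std_normal_density).
      iexp (\<Sum>i<\<nu>. c * g i * m i) * exp (- (\<Sum>i<\<nu>. (c * g i)\<^sup>2) / 2)) =
    exp (- (c\<^sup>2 * (\<Sum>i<\<nu>. (m i)\<^sup>2) / 2 / (1 + c\<^sup>2))) / sqrt (1 + c\<^sup>2) ^ \<nu>"
proof -
  interpret product_prob_space "\<lambda>i. density lborel std_normal_density"
    using product_prob_space_normal[of "\<lambda>_. 0"] by simp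
  have "(CLINT g|PiM {..<\<nu>} (\<lambda>i. density lborel std_normal_density).
      iexp (\<Sum>i<\<nu>. c * g i * m i) * exp (- (\<Sum>i<\<nu>. (c * g i)\<^sup>2) / 2)) =
    (CLINT g|PiM {..<\<nu>} (\<lambda>i. density lborel std_normal_density).
      (\<Prod>i<\<nu>. iexp (c * m i * g i) * exp (- (c\<^sup>2 * (g i)\<^sup>2 / 2))))"
  proof (rule Bochner_Integration.integral_cong[OF refl])
    fix g :: "nat \<Rightarrow> real"
    have "iexp (\<Sum>i<\<nu>. c * g i * m i) = (\<Prod>i<\<nu>. iexp (c * m i * g i))"
      by (subst iexp_sum) (simp_all add: mult_ac)
    moreover have "exp (- (\<Sum>i<\<nu>. (c * g i)\<^sup>2) / 2) = (\<Prod>i<\<nu>. exp (- (c\<^sup>2 * (g i)\<^sup>2 / 2)))"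
      by (simp add: exp_sum[symmetric] sum_divide_distrib sum_negf power_mult_distrib)
    ultimately show "iexp (\<Sum>i<\<nu>. c * g i * m i) * exp (- (\<Sum>i<\<nu>. (c * g i)\<^sup>2) / 2) =
       (\<Prod>i<\<nu>. iexp (c * m i * g i) * exp (- (c\<^sup>2 * (g i)\<^sup>2 / 2)))"
      by (simp only: prod.distrib of_real_prod)
  qed
  also have "\<dots> = (\<Prod>i<\<nu>. CLINT x|density lborel std_normal_density. iexp (c * m i * x) * exp (- (c\<^sup>2 * x\<^sup>2 / 2)))"
  proof (rule product_integral_prod)
    fix i
    show "integrable (density lborel std_normal_density) (\<lambda>x. iexp (c * m i * x) * exp (- (c\<^sup>2 * x\<^sup>2 / 2)))"
      by (rule M.integrable_const_bound[of _ 1]) (auto simp: norm_mult)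
  qed simp
  also have "\<dots> = exp (- (c\<^sup>2 * (\<Sum>i<\<nu>. (m i)\<^sup>2) / 2 / (1 + c\<^sup>2))) / sqrt (1 + c\<^sup>2) ^ \<nu>"
    unfolding CLINT_normal_iexp_exp_square
    by (simp only: of_real_prod[symmetric] prod_dividef exp_sum[symmetric] finite_lessThan
        sum_negf sum_distrib_left sum_divide_distrib prod_constant card_lessThan)
  finally show ?thesis .
qed

text \<open>Linearisation writes each Laplace transform of the sum of squares as a Gaussian average
  of characteristic functions, and dominated convergence moves the limit inside. The vectors
  \<open>m\<close> and \<open>\<mu>\<close> need only have equal norms, as the Laplace transform of
  the limit sees nothing else.\<close>

lemma weak_conv_m_sum_squares_normal:
  fixes Q :: "nat \<Rightarrow> 'b pmf" and Y :: "nat \<Rightarrow> 'b \<Rightarrow> nat \<Rightarrow> real"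
  assumes fin: "\<And>n. finite (set_pmf (Q n))"
    and char: "\<And>g. (\<lambda>n. CLINT z|Q n. iexp (\<Sum>i<\<nu>. g i * Y n z i)) \<longlonglongrightarrow>
       iexp (\<Sum>i<\<nu>. g i * m i) * exp (- (\<Sum>i<\<nu>. (g i)\<^sup>2) / 2)"
    and eq: "(\<Sum>i<\<nu>. (m i)\<^sup>2) = (\<Sum>i<\<nu>. (\<mu> i)\<^sup>2)"
  shows "weak_conv_m (\<lambda>n. distr (Q n) borel (\<lambda>z. \<Sum>i<\<nu>. (Y n z i)\<^sup>2)) (norm2_normal_law \<nu> \<mu>)"
proof (rule weak_conv_m_nonneg_Laplace)
  show "real_distribution (distr (Q n) borel (\<lambda>z. \<Sum>i<\<nu>. (Y n z i)\<^sup>2))" for n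
    by (rule prob_space.real_distribution_distr[OF measure_pmf.prob_space_axioms]) simp
  show "real_distribution (norm2_normal_law \<nu> \<mu>)"
    by (rule real_distribution_norm2_normal_law)
  show "AE x in distr (Q n) borel (\<lambda>z. \<Sum>i<\<nu>. (Y n z i)\<^sup>2). 0 \<le> x" for n
    by (subst AE_distr_iff) (auto intro!: sum_nonneg)
  show "AE x in norm2_normal_law \<nu> \<mu>. 0 \<le> x"
    by (rule AE_norm2_normal_law_nonneg)
next
  fix k :: nat
  \<comment> \<open>Chosen so that k |y|^2 = |c y|^2 / 2, the exponent in the linearisation
    identity.\<close>
  define c where "c = sqrt (2 * real k)"
  have c2: "c\<^sup>2 = 2 * real k" by (simp add: c_def)
  let ?G = "PiM {..<\<nu>} (\<lambda>i::nat. density lborel std_normal_density)"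
  interpret PN: product_prob_space "\<lambda>i::nat. density lborel std_normal_density"
    using product_prob_space_normal[of "\<lambda>_. 0"] by simp
  interpret G: prob_space ?G by (rule prob_space_PiM[OF PN.M.prob_space_axioms])
  \<comment> \<open>Finite support makes the inner integral a finite sum, so exchanging it with the
    Gaussian integral is plain linearity.\<close>
  have L: "complex_of_real (\<integral>x. exp (- (real k * x)) \<partial>distr (Q n) borel (\<lambda>z. \<Sum>i<\<nu>. (Y n z i)\<^sup>2)) =
     (CLINT g|?G. CLINT z|Q n. iexp (\<Sum>i<\<nu>. (c * g i) * Y n z i))" (is "?l = ?r") for n
  proof -
    let ?S = "set_pmf (Q n)"
    have "?l = complex_of_real (\<integral>z. exp (- (\<Sum>i<\<nu>. (c * Y n z i)\<^sup>2) / 2) \<partial>Q n)"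
      by (subst integral_distr) (auto simp: power_mult_distrib c2 sum_distrib_left[symmetric])
    also have "\<dots> = (\<Sum>z\<in>?S. pmf (Q n) z *\<^sub>R complex_of_real (exp (- (\<Sum>i<\<nu>. (c * Y n z i)\<^sup>2) / 2)))"
      by (subst integral_measure_pmf[OF fin]) (auto simp: scaleR_conv_of_real)
    also have "\<dots> = (\<Sum>z\<in>?S. CLINT g|?G. pmf (Q n) z *\<^sub>R iexp (\<Sum>i<\<nu>. g i * (c * Y n z i)))"
      by (simp only: CLINT_PiM_std_normal_iexp[symmetric] integral_scaleR_right)
    also have "\<dots> = (CLINT g|?G. \<Sum>z\<in>?S. pmf (Q n) z *\<^sub>R iexp (\<Sum>i<\<nu>. g i * (c * Y n z i)))"
      by (rule Bochner_Integration.integral_sum[symmetric])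
        (auto intro!: integrable_scaleR_right G.integrable_const_bound[of _ 1])
    also have "\<dots> = ?r"
    proof (rule Bochner_Integration.integral_cong[OF refl])
      fix g
      show "(\<Sum>z\<in>?S. pmf (Q n) z *\<^sub>R iexp (\<Sum>i<\<nu>. g i * (c * Y n z i))) =
         (CLINT z|Q n. iexp (\<Sum>i<\<nu>. (c * g i) * Y n z i))"
        by (subst integral_measure_pmf[OF fin]) (auto simp: mult_ac)
    qed
    finally show ?thesis .
  qed
  have "(\<lambda>n. CLINT g|?G. CLINT z|Q n. iexp (\<Sum>i<\<nu>. (c * g i) * Y n z i)) \<longlonglongrightarrow>
     (CLINT g|?G. iexp (\<Sum>i<\<nu>. c * g i * m i) * exp (- (\<Sum>i<\<nu>. (c * g i)\<^sup>2) / 2))"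
  \<comment> \<open>Characteristic functions have modulus at most 1, so the constant 1 dominates
    under the probability measure \<open>?G\<close>.\<close>
  proof (rule integral_dominated_convergence[where w="\<lambda>_. 1"])
    fix n
    have "(\<lambda>g. CLINT z|Q n. iexp (\<Sum>i<\<nu>. (c * g i) * Y n z i)) =
      (\<lambda>g. \<Sum>z\<in>set_pmf (Q n). pmf (Q n) z *\<^sub>R iexp (\<Sum>i<\<nu>. (c * g i) * Y n z i))"
      by (intro ext integral_measure_pmf[OF fin])
    then show "(\<lambda>g. CLINT z|Q n. iexp (\<Sum>i<\<nu>. (c * g i) * Y n z i)) \<in> borel_measurable ?G"
      by simp
    show "AE g in ?G. cmod (CLINT z|Q n. iexp (\<Sum>i<\<nu>. (c * g i) * Y n z i)) \<le> 1"
    proof (rule AE_I2)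
      fix g
      have "cmod (CLINT z|Q n. iexp (\<Sum>i<\<nu>. (c * g i) * Y n z i)) \<le>
        (\<integral>z. cmod (iexp (\<Sum>i<\<nu>. (c * g i) * Y n z i)) \<partial>Q n)"
        by (rule integral_norm_bound)
      also have "\<dots> = 1" by simp
      finally show "cmod (CLINT z|Q n. iexp (\<Sum>i<\<nu>. (c * g i) * Y n z i)) \<le> 1" .
    qed
    show "AE g in ?G. (\<lambda>n. CLINT z|Q n. iexp (\<Sum>i<\<nu>. (c * g i) * Y n z i)) \<longlonglongrightarrow>
        iexp (\<Sum>i<\<nu>. c * g i * m i) * exp (- (\<Sum>i<\<nu>. (c * g i)\<^sup>2) / 2)"
      by (rule AE_I2) (rule char)
  qed auto
  also have "(CLINT g|?G. iexp (\<Sum>i<\<nu>. c * g i * m i) * exp (- (\<Sum>i<\<nu>. (c * g i)\<^sup>2) / 2)) =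
     complex_of_real (\<integral>x. exp (- (real k * x)) \<partial>norm2_normal_law \<nu> \<mu>)"
    unfolding CLINT_PiM_std_normal_iexp_exp_square by (simp add: Laplace_norm2_normal_law eq c2)
  finally show "(\<lambda>n. \<integral>x. exp (- (real k * x)) \<partial>distr (Q n) borel (\<lambda>z. \<Sum>i<\<nu>. (Y n z i)\<^sup>2)) \<longlonglongrightarrow>
     (\<integral>x. exp (- (real k * x)) \<partial>norm2_normal_law \<nu> \<mu>)"
    unfolding L[symmetric] tendsto_of_real_iff .
qed

section \<open>Characteristic functions of triangular arrays\<close>

text \<open>The difference quotient of exp (L h) at h = 0, taken along h = 1 / n.\<close>

lemma tendsto_nat_times_exp_minus_1:
  fixes L :: complex
  shows "(\<lambda>n. of_nat n * (exp (L / of_nat n) - 1)) \<longlonglongrightarrow> L"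
proof -
  have "((\<lambda>x. exp (L * x)) has_field_derivative L) (at 0)"
    by (auto intro!: derivative_eq_intros)
  then have lim: "((\<lambda>h. (exp (L * h) - 1) / h) \<longlongrightarrow> L) (at 0)"
    by (simp add: has_field_derivative_def DERIV_def flip: has_field_derivative_def)
  have "filterlim (\<lambda>n. inverse (of_nat n) :: complex) (at 0) sequentially"
    by (rule filterlim_atI) (auto intro!: tendsto_inverse_0_at_top lim_inverse_n eventually_sequentiallyI[of 1])
  from filterlim_compose[OF lim this] show ?thesis
    by (simp add: divide_inverse mult.commute)
qed

text \<open>A central limit theorem for rows of i.i.d. variables with a common finite support. Means
  of order 1 / sqrt n add a drift to the limit but vanish in the variance, so raw second moments may
  stand for variances. A second-order Taylor expansion gives n (\<phi> n - 1)
  \<longlonglongrightarrow> L, and the n-th power is then compared with that of exp (L / n).\<close>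

lemma char_power_tendsto:
  fixes q :: "nat \<Rightarrow> 'a pmf" and X :: "'a \<Rightarrow> real"
  assumes "finite S" and supp: "\<And>n. set_pmf (q n) \<subseteq> S"
    and mean: "(\<lambda>n. sqrt (real n) * measure_pmf.expectation (q n) X) \<longlonglongrightarrow> m"
    and second: "(\<lambda>n. measure_pmf.expectation (q n) (\<lambda>z. (X z)\<^sup>2)) \<longlonglongrightarrow> v"
  shows "(\<lambda>n. (CLINT z|q n. iexp (X z / sqrt (real n))) ^ n) \<longlonglongrightarrow> iexp m * exp (- v / 2)"
proof -
  define K where "K = Max (insert 0 ((\<lambda>z. \<bar>X z\<bar>) ` S))"
  have K: "\<bar>X z\<bar> \<le> K" if "z \<in> S" for z
    unfolding K_def using \<open>finite S\<close> that by (intro Max_ge) auto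
  have K0: "K \<ge> 0"
    unfolding K_def using \<open>finite S\<close> by (intro Max_ge) auto
  have fin: "finite (set_pmf (q n))" for n
    using supp \<open>finite S\<close> by (rule finite_subset)
  note int [intro, simp] = integrable_measure_pmf_finite[OF fin]
  \<comment> \<open>Puts exp (L / n) into the closed unit disc, as the comparison of n-th powers
    requires.\<close>
  have "v \<ge> 0"
    by (rule LIMSEQ_le_const[OF second]) (auto intro!: integral_nonneg)
  define L where "L = \<i> * m - v / 2"
  define \<phi> where "\<phi> n = (CLINT z|q n. iexp (X z / sqrt (real n)))" for n :: nat
  have exp_L: "exp L = iexp m * exp (- v / 2)"
  proof -
    have "L = \<i> * m + complex_of_real (- v / 2)" by (simp add: L_def)
    then show ?thesis by (simp only: exp_add exp_of_real)
  qed
  have "(\<lambda>n. \<i> * (sqrt (real n) * measure_pmf.expectation (q n) X)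
      - measure_pmf.expectation (q n) (\<lambda>z. (X z)\<^sup>2) / 2) \<longlonglongrightarrow> L"
    unfolding L_def by (intro tendsto_diff tendsto_mult_left tendsto_of_real mean tendsto_divide second tendsto_const) simp
  \<comment> \<open>The Taylor remainder of one factor is at most |X / sqrt n|^3 / 6; multiplied by
    n it is still of order 1 / sqrt n.\<close>
  moreover have "(\<lambda>n. of_nat n * (\<phi> n - 1) - (\<i> * (sqrt (real n) * measure_pmf.expectation (q n) X)
      - measure_pmf.expectation (q n) (\<lambda>z. (X z)\<^sup>2) / 2)) \<longlonglongrightarrow> 0"
  proof (rule Lim_null_comparison)
    show "\<forall>\<^sub>F n in sequentially. norm (of_nat n * (\<phi> n - 1) - (\<i> * (sqrt (real n) * measure_pmf.expectation (q n) X)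
      - measure_pmf.expectation (q n) (\<lambda>z. (X z)\<^sup>2) / 2)) \<le> K ^ 3 / 6 * inverse (sqrt (real n))"
      using eventually_ge_at_top[of 1]
    proof eventually_elim
      fix n :: nat assume n: "1 \<le> n"
      let ?r = "\<lambda>z. of_nat n * (iexp (X z / sqrt (real n)) - 1) - (\<i> * (sqrt (real n) * X z) - (X z)\<^sup>2 / 2)"
      have "of_nat n * (\<phi> n - 1) - (\<i> * (sqrt (real n) * measure_pmf.expectation (q n) X)
        - measure_pmf.expectation (q n) (\<lambda>z. (X z)\<^sup>2) / 2) = (CLINT z|q n. ?r z)"
        unfolding \<phi>_def by simp (simp flip: of_real_power)
      also have "norm \<dots> \<le> (\<integral>z. norm (?r z) \<partial>q n)"
        by (rule integral_norm_bound)
      also have "\<dots> \<le> (\<integral>z. K ^ 3 / 6 * inverse (sqrt (real n)) \<partial>q n)"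
      proof (rule integral_mono_AE)
        show "AE z in q n. norm (?r z) \<le> K ^ 3 / 6 * inverse (sqrt (real n))"
          unfolding AE_measure_pmf_iff
        proof
          fix z assume "z \<in> set_pmf (q n)"
          then have z: "\<bar>X z\<bar> \<le> K" using supp K by blast
          let ?t = "X z / sqrt (real n)"
          have n2: "sqrt (real n) * sqrt (real n) = real n" "sqrt (real n) > 0" using n by auto
          have gen: "r * r * (a / r) = r * a" "r * r * (a / r)\<^sup>2 = a\<^sup>2"
            "r * r * ((a / r) ^ 3 / 6) = a ^ 3 / 6 * inverse r" if "r > 0" for a r :: real
            using that by (simp_all add: field_simps power2_eq_square power3_eq_cube)
          have nt: "real n * ?t = sqrt (real n) * X z" "real n * ?t\<^sup>2 = (X z)\<^sup>2"
            using gen(1,2)[OF n2(2)] n2(1) by metis+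
          have "?r z = of_nat n * (iexp ?t - (\<Sum>k\<le>2. (\<i> * ?t) ^ k / fact k))"
          proof -
            have taylor: "(\<Sum>k\<le>2. (\<i> * t) ^ k / fact k) = 1 + \<i> * t - t\<^sup>2 / 2" for t :: real
              by (simp add: numeral_2_eq_2 algebra_simps)
            have "\<i> * (sqrt (real n) * X z) - (X z)\<^sup>2 / 2 = of_nat n * (\<i> * ?t - ?t\<^sup>2 / 2)"
              unfolding nt[symmetric] by (simp only: of_real_mult of_real_of_nat_eq of_real_divide right_diff_distrib mult.left_commute times_divide_eq_right of_real_numeral)
            moreover have "N * (e - 1) - N * (a - b) = N * (e - (1 + a - b))" for N e a b :: complex
              by (simp add: algebra_simps)
            ultimately show ?thesis unfolding taylor by (simp only:)
          qed
          then have "norm (?r z) = real n * cmod (iexp ?t - (\<Sum>k\<le>2. (\<i> * ?t) ^ k / fact k))"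
            by (simp only: norm_mult norm_of_nat)
          also have "\<dots> \<le> real n * (\<bar>?t\<bar> ^ 3 / 6)"
            using iexp_approx1[of ?t 2] by (intro mult_left_mono) (auto simp: fact_numeral numeral_3_eq_3)
          also have "\<dots> = \<bar>X z\<bar> ^ 3 / 6 * inverse (sqrt (real n))"
            using gen(3)[OF n2(2), of "\<bar>X z\<bar>"] n2 by (simp only: abs_divide abs_of_pos)
          also have "\<dots> \<le> K ^ 3 / 6 * inverse (sqrt (real n))"
            using z by (intro mult_right_mono divide_right_mono power_mono) auto
          finally show "norm (?r z) \<le> K ^ 3 / 6 * inverse (sqrt (real n))" .
        qed
      qed auto
      also have "\<dots> = K ^ 3 / 6 * inverse (sqrt (real n))" by simp
      finally show "norm (of_nat n * (\<phi> n - 1) - (\<i> * (sqrt (real n) * measure_pmf.expectation (q n) X)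
        - measure_pmf.expectation (q n) (\<lambda>z. (X z)\<^sup>2) / 2)) \<le> K ^ 3 / 6 * inverse (sqrt (real n))" .
    qed
    show "(\<lambda>n. K ^ 3 / 6 * inverse (sqrt (real n))) \<longlonglongrightarrow> 0"
      by (intro tendsto_mult_right_zero tendsto_inverse_0_at_top
          filterlim_compose[OF sqrt_at_top filterlim_real_sequentially])
  qed
  ultimately have "(\<lambda>n. of_nat n * (\<phi> n - 1)) \<longlonglongrightarrow> L"
    by (rule Lim_transform)
  from tendsto_diff[OF this tendsto_nat_times_exp_minus_1[of L]]
  have diff: "(\<lambda>n. of_nat n * (\<phi> n - exp (L / of_nat n))) \<longlonglongrightarrow> 0"
    by (simp add: algebra_simps)
  have "(\<lambda>n. \<phi> n ^ n - exp L) \<longlonglongrightarrow> 0"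
  proof (rule Lim_null_comparison)
    show "\<forall>\<^sub>F n in sequentially. norm (\<phi> n ^ n - exp L) \<le> norm (of_nat n * (\<phi> n - exp (L / of_nat n)))"
      using eventually_ge_at_top[of 1]
    proof eventually_elim
      fix n :: nat assume n: "1 \<le> n"
      have "norm (\<phi> n) \<le> (\<integral>z. norm (iexp (X z / sqrt (real n))) \<partial>q n)"
        unfolding \<phi>_def by (rule integral_norm_bound)
      then have "norm (\<phi> n) \<le> 1" by simp
      moreover have "norm (exp (L / of_nat n)) \<le> 1"
        using \<open>v \<ge> 0\<close> by (simp add: L_def)
      \<comment> \<open>In the closed unit disc, |a^n - b^n| \<le> n |a - b|, and
        \<open>diff\<close> says that this bound tends to 0.\<close>
      ultimately have "norm (\<phi> n ^ n - exp (L / of_nat n) ^ n) \<le> n * norm (\<phi> n - exp (L / of_nat n))"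
        by (rule norm_power_diff)
      also have "exp (L / of_nat n) ^ n = exp L"
        using n by (simp add: exp_of_nat_mult[symmetric])
      finally show "norm (\<phi> n ^ n - exp L) \<le> norm (of_nat n * (\<phi> n - exp (L / of_nat n)))"
        by (simp add: norm_mult)
    qed
    show "(\<lambda>n. norm (of_nat n * (\<phi> n - exp (L / of_nat n)))) \<longlonglongrightarrow> 0"
      using diff by (rule tendsto_norm_zero)
  qed
  then show ?thesis
    unfolding exp_L[symmetric] \<phi>_def by (simp add: LIM_zero_iff)
qed

section \<open>Expectations over independent families\<close>

lemma CLINT_Pi_pmf_prod:
  fixes h :: "'i \<Rightarrow> 'a \<Rightarrow> complex"
  assumes "finite A" and fin: "\<And>i. i \<in> A \<Longrightarrow> finite (set_pmf (p i))"
  shows "(CLINT f|Pi_pmf A d p. \<Prod>i\<in>A. h i (f i)) = (\<Prod>i\<in>A. CLINT x|p i. h i x)"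
proof -
  have comp: "(CLINT f|Pi_pmf A d p. h i (f i)) = (CLINT x|p i. h i x)" if "i \<in> A" for i
    using Pi_pmf_component[OF \<open>finite A\<close>, of i d p] that by (metis integral_map_pmf)
  have "finite (set_pmf (Pi_pmf A d p))"
    using assms by (auto simp: set_Pi_pmf intro!: finite_PiE_dflt)
  then have "(CLINT f|Pi_pmf A d p. \<Prod>i\<in>A. h i (f i)) = (\<Prod>i\<in>A. CLINT f|Pi_pmf A d p. h i (f i))"
    by (intro prob_space.indep_vars_lebesgue_integral[OF measure_pmf.prob_space_axioms]
        prob_space.indep_vars_compose2[OF measure_pmf.prob_space_axioms indep_vars_Pi_pmf]
        integrable_measure_pmf_finite assms) auto
  with comp show ?thesis by simp
qed

lemma integral_bind_pmf_finite:
  fixes h :: "'b \<Rightarrow> 'c :: {banach, second_countable_topology}"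
  assumes "finite (set_pmf p)" "\<And>x. x \<in> set_pmf p \<Longrightarrow> finite (set_pmf (f x))"
  shows "measure_pmf.expectation (bind_pmf p f) h =
    measure_pmf.expectation p (\<lambda>x. measure_pmf.expectation (f x) h)"
  by (subst pmf_expectation_bind[OF assms order_refl]) (auto simp: integral_measure_pmf[OF assms(1)])

text \<open>Centred independent summands are uncorrelated, so the cross terms of the square vanish.
  The offset \<open>s\<close> will be the conditional mean of a privatised record.\<close>

lemma expectation_Pi_pmf_sum_square:
  fixes g :: "'i \<Rightarrow> 'a \<Rightarrow> real"
  assumes "finite A" and fin: "\<And>i. i \<in> A \<Longrightarrow> finite (set_pmf (p i))"
    and mean: "\<And>i. i \<in> A \<Longrightarrow> measure_pmf.expectation (p i) (g i) = 0"
  shows "measure_pmf.expectation (Pi_pmf A d p) (\<lambda>f. s + (\<Sum>i\<in>A. g i (f i))) = s"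
    and "measure_pmf.expectation (Pi_pmf A d p) (\<lambda>f. (s + (\<Sum>i\<in>A. g i (f i)))\<^sup>2) =
      s\<^sup>2 + (\<Sum>i\<in>A. measure_pmf.expectation (p i) (\<lambda>x. (g i x)\<^sup>2))"
proof -
  have *: "measure_pmf.expectation (Pi_pmf A d p) (\<lambda>f. s + (\<Sum>i\<in>A. g i (f i))) = s \<and>
    measure_pmf.expectation (Pi_pmf A d p) (\<lambda>f. (s + (\<Sum>i\<in>A. g i (f i)))\<^sup>2) =
      s\<^sup>2 + (\<Sum>i\<in>A. measure_pmf.expectation (p i) (\<lambda>x. (g i x)\<^sup>2))"
    using assms
  \<comment> \<open>The offset must vary: drawing the new coordinate first replaces \<open>s\<close>
    by \<open>s + g x y\<close> in the induction hypothesis.\<close>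
  proof (induction A arbitrary: s rule: finite_induct)
    case (insert x A)
    have finA: "finite (set_pmf (Pi_pmf A d p))"
      using insert.hyps insert.prems(1) by (auto simp: set_Pi_pmf intro!: finite_PiE_dflt)
    have finx: "finite (set_pmf (p x))" using insert.prems(1) by simp
    note int [simp] = integrable_measure_pmf_finite[OF finx]
    have upd: "s + (\<Sum>i\<in>insert x A. g i ((f(x := y)) i)) = (s + g x y) + (\<Sum>i\<in>A. g i (f i))" for f y
    proof -
      have "(\<Sum>i\<in>A. g i ((f(x := y)) i)) = (\<Sum>i\<in>A. g i (f i))"
        using insert.hyps by (intro sum.cong) auto
      with insert.hyps show ?thesis by simp
    qed
    have ins: "Pi_pmf (insert x A) d p = bind_pmf (p x) (\<lambda>y. map_pmf (\<lambda>f. f(x := y)) (Pi_pmf A d p))"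
      using insert.hyps by (simp add: Pi_pmf_insert' map_pmf_def)
    have bind: "measure_pmf.expectation (Pi_pmf (insert x A) d p) (\<lambda>f. H (s + (\<Sum>i\<in>insert x A. g i (f i)))) =
        measure_pmf.expectation (p x) (\<lambda>y. measure_pmf.expectation (Pi_pmf A d p)
           (\<lambda>f. H ((s + g x y) + (\<Sum>i\<in>A. g i (f i)))))" for H :: "real \<Rightarrow> real"
      unfolding ins using finA finx
      by (subst integral_bind_pmf_finite) (auto simp only: integral_map_pmf upd set_map_pmf finite_imageI)
    have IH: "measure_pmf.expectation (Pi_pmf A d p) (\<lambda>f. t + (\<Sum>i\<in>A. g i (f i))) = t"
      "measure_pmf.expectation (Pi_pmf A d p) (\<lambda>f. (t + (\<Sum>i\<in>A. g i (f i)))\<^sup>2) =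
        t\<^sup>2 + (\<Sum>i\<in>A. measure_pmf.expectation (p i) (\<lambda>x. (g i x)\<^sup>2))" for t
      using insert.IH[of t] insert.prems by auto
    have "measure_pmf.expectation (p x) (g x) = 0"
      using insert.prems by simp
    then have "measure_pmf.expectation (p x) (\<lambda>y. s + g x y) = s"
      and "measure_pmf.expectation (p x) (\<lambda>y. (s + g x y)\<^sup>2 + V) =
        s\<^sup>2 + (measure_pmf.expectation (p x) (\<lambda>y. (g x y)\<^sup>2) + V)" for V
      by (simp_all add: power2_sum)
    then show ?case
      using bind[of "\<lambda>t. t"] bind[of "\<lambda>t. t\<^sup>2"] insert.hyps by (simp only: IH sum.insert simp_thms)
  qed simp
  then show "measure_pmf.expectation (Pi_pmf A d p) (\<lambda>f. s + (\<Sum>i\<in>A. g i (f i))) = s"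
    and "measure_pmf.expectation (Pi_pmf A d p) (\<lambda>f. (s + (\<Sum>i\<in>A. g i (f i)))\<^sup>2) =
      s\<^sup>2 + (\<Sum>i\<in>A. measure_pmf.expectation (p i) (\<lambda>x. (g i x)\<^sup>2))"
    by auto
qed

section \<open>The bit-flip mechanism\<close>

definition bit_flip_sample_pmf :: "real ^ 'd \<Rightarrow> real \<Rightarrow> (real ^ 'd) pmf" where
  "bit_flip_sample_pmf p \<epsilon> = bind_pmf (multinomial1_pmf p) (\<lambda>x. bit_flip_pmf x \<epsilon>)"

text \<open>Coordinatewise binding commutes with the product law. The two-stage sampling thus
  becomes a sum of i.i.d. records, each with its data entry averaged out.\<close>

lemma private_histogram_pmf_eq:
  "private_histogram_pmf n p \<epsilon> =
    map_pmf (\<lambda>Z. \<Sum>i\<in>{1..n}. Z i) (Pi_pmf {1..n} 0 (\<lambda>_. bit_flip_sample_pmf p \<epsilon>))"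
  unfolding private_histogram_pmf_def bit_flip_sample_pmf_def
  by (subst Pi_pmf_bind[where d' = 0]) (simp_all add: map_pmf_def bind_assoc_pmf)

lemma set_bit_flip_pmf_subset:
  fixes x :: "real ^ 'd"
  assumes "\<And>j. x $ j \<in> {0, 1}"
  shows "set_pmf (bit_flip_pmf x \<epsilon>) \<subseteq> (\<lambda>z. \<chi> j. z j) ` PiE_dflt UNIV 0 (\<lambda>_. {0, 1})"
proof -
  let ?B = "\<lambda>j. map_pmf (\<lambda>keep. if keep then x $ j else 1 - x $ j)
            (bernoulli_pmf (exp (\<epsilon> / 2) / (exp (\<epsilon> / 2) + 1)))"
  have "set_pmf (?B j) \<subseteq> {0, 1}" for j
    using assms[of j] by (auto split: if_splits)
  then have "set_pmf (Pi_pmf UNIV 0 ?B) \<subseteq> PiE_dflt UNIV 0 (\<lambda>_. {0, 1})"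
    by (subst set_Pi_pmf) (fastforce simp: PiE_dflt_def)+
  then show ?thesis
    unfolding bit_flip_pmf_def by auto
qed

lemma finite_set_bit_flip_pmf: "finite (set_pmf (bit_flip_pmf x \<epsilon>))"
  unfolding bit_flip_pmf_def by (auto simp: set_Pi_pmf intro!: finite_imageI finite_PiE_dflt)

text \<open>The bound does not depend on \<open>p\<close>, so it is the common finite support that
  the central limit theorem asks for when \<open>p\<close> varies with n.\<close>

lemma set_bit_flip_sample_pmf_subset:
  "set_pmf (bit_flip_sample_pmf p \<epsilon>) \<subseteq> (\<lambda>z. \<chi> j. z j) ` PiE_dflt UNIV 0 (\<lambda>_. {0, 1})"
  unfolding bit_flip_sample_pmf_def multinomial1_pmf_def set_bind_pmf set_map_pmf
  by (intro UN_least set_bit_flip_pmf_subset) (auto simp: axis_def)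

lemma finite_set_bit_flip_sample_pmf: "finite (set_pmf (bit_flip_sample_pmf p \<epsilon>))"
  by (rule finite_subset[OF set_bit_flip_sample_pmf_subset]) (intro finite_imageI finite_PiE_dflt; simp)

lemma finite_set_private_histogram_pmf: "finite (set_pmf (private_histogram_pmf n p \<epsilon>))"
  unfolding private_histogram_pmf_eq
  by (auto simp: set_Pi_pmf intro!: finite_imageI finite_PiE_dflt finite_set_bit_flip_sample_pmf)

text \<open>Given \<open>x\<close>, the centred output has mean \<alpha> (x - p0), plus independent
  noise in every bit. The noise variance is the same for both values of a bit, which gives the
  multiple of the identity in \<Sigma>.\<close>

lemma expectation_bit_flip_pmf_inner:
  fixes x u :: "real ^ 'd"
  assumes x: "\<And>j. x $ j \<in> {0, 1}"
  shows "measure_pmf.expectation (bit_flip_pmf x \<epsilon>) (\<lambda>z. u \<bullet> (z - p_tilde \<epsilon> p0)) =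
      alpha_eps \<epsilon> * (u \<bullet> (x - p0))" (is ?mean)
    and "measure_pmf.expectation (bit_flip_pmf x \<epsilon>) (\<lambda>z. (u \<bullet> (z - p_tilde \<epsilon> p0))\<^sup>2) =
      (alpha_eps \<epsilon> * (u \<bullet> (x - p0)))\<^sup>2 + exp (\<epsilon> / 2) / (exp (\<epsilon> / 2) + 1)\<^sup>2 * (u \<bullet> u)" (is ?second)
proof -
  define e where "e = exp (\<epsilon> / 2)"
  have e: "e > 0" by (simp add: e_def)
  then have e1: "e + 1 \<noteq> 0" by linarith
  define b where "b = e / (e + 1)"
  have b: "0 \<le> b" "b \<le> 1" using e by (auto simp: b_def)
  define B where "B = (\<lambda>j. map_pmf (\<lambda>keep. if keep then x $ j else 1 - x $ j) (bernoulli_pmf b))"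
  \<comment> \<open>Here \<open>s\<close> is the conditional mean given \<open>x\<close>, and
    \<open>g j\<close> is the centred noise of bit \<open>j\<close> weighted by \<open>u\<close>;
    \<open>b\<close> is the probability of keeping a bit.\<close>
  define s where "s = alpha_eps \<epsilon> * (u \<bullet> (x - p0))"
  define g where "g j t = u $ j * (t - (b * x $ j + (1 - b) * (1 - x $ j)))" for j t
  have \<alpha>: "alpha_eps \<epsilon> = 2 * b - 1" "p_tilde \<epsilon> p0 $ j = (2 * b - 1) * p0 $ j + (1 - b)" for j
    using e1 by (simp_all add: alpha_eps_def p_tilde_def b_def e_def[symmetric] field_simps)
  have E: "measure_pmf.expectation (bit_flip_pmf x \<epsilon>) (\<lambda>z. h (u \<bullet> (z - p_tilde \<epsilon> p0))) =
     measure_pmf.expectation (Pi_pmf UNIV 0 B) (\<lambda>f. h (s + (\<Sum>j\<in>UNIV. g j (f j))))" for h :: "real \<Rightarrow> real"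
  proof -
    have "u \<bullet> ((\<chi> j. f j) - p_tilde \<epsilon> p0) = s + (\<Sum>j\<in>UNIV. g j (f j))" for f :: "'d \<Rightarrow> real"
      unfolding s_def g_def inner_vec_def sum_distrib_left sum.distrib[symmetric]
      by (rule sum.cong) (auto simp: \<alpha> algebra_simps)
    then show ?thesis
      unfolding bit_flip_pmf_def B_def b_def e_def by simp
  qed
  have fin: "finite (set_pmf (B j))" for j
    by (simp add: B_def)
  have mean: "measure_pmf.expectation (B j) (g j) = 0" for j
    using b by (simp add: B_def g_def algebra_simps)
  have var: "measure_pmf.expectation (B j) (\<lambda>t. (g j t)\<^sup>2) = b * (1 - b) * (u $ j)\<^sup>2" for j
    using b x[of j] by (auto simp: B_def g_def power2_eq_square algebra_simps)
  have "b * (1 - b) = e / (e + 1)\<^sup>2"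
    using e1 by (simp add: b_def power2_eq_square field_simps)
  then have "(\<Sum>j\<in>UNIV. b * (1 - b) * (u $ j)\<^sup>2) = e / (e + 1)\<^sup>2 * (u \<bullet> u)"
    by (simp add: inner_vec_def power2_eq_square sum_distrib_left)
  then show ?mean ?second
    using E[of "\<lambda>t. t"] E[of "\<lambda>t. t\<^sup>2"]
      expectation_Pi_pmf_sum_square[where A = UNIV and p = B and g = g and d = 0 and s = s, OF finite fin mean]
    by (simp_all only: var s_def e_def)
qed

text \<open>The hypotheses make \<open>embed_pmf\<close> a genuine law with weights
  \<open>p\<close>; the expectation is then conditioned on the drawn basis vector.\<close>

lemma expectation_bit_flip_sample_pmf:
  fixes p :: "real ^ 'd" and h :: "real ^ 'd \<Rightarrow> real"
  assumes p: "\<And>j. 0 \<le> p $ j" "(\<Sum>j\<in>UNIV. p $ j) = 1"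
  shows "measure_pmf.expectation (bit_flip_sample_pmf p \<epsilon>) h =
    (\<Sum>j\<in>UNIV. p $ j * measure_pmf.expectation (bit_flip_pmf (axis j 1) \<epsilon>) h)"
proof -
  have "(\<integral>\<^sup>+ j. ennreal (p $ j) \<partial>count_space UNIV) = 1"
    using p by (simp add: nn_integral_count_space_finite sum_ennreal)
  then have "pmf (embed_pmf (\<lambda>j. p $ j)) j = p $ j" for j
    using p(1) by (intro pmf_embed_pmf) auto
  then show ?thesis
    unfolding bit_flip_sample_pmf_def multinomial1_pmf_def bind_map_pmf
    by (subst pmf_expectation_bind[where A = UNIV]) (auto simp: finite_set_bit_flip_pmf)
qed

text \<open>Averages the conditional moments over x = e_j. Data come from \<open>p\<close> while the
  centring uses \<open>p0\<close>, so the mean is a drift and the second moment is not a variance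
  unless p = p0 or the drift vanishes.\<close>

lemma expectation_bit_flip_sample_pmf_inner:
  fixes p u :: "real ^ 'd"
  assumes p: "\<And>j. 0 \<le> p $ j" "(\<Sum>j\<in>UNIV. p $ j) = 1"
  shows "measure_pmf.expectation (bit_flip_sample_pmf p \<epsilon>) (\<lambda>z. u \<bullet> (z - p_tilde \<epsilon> p0)) =
      alpha_eps \<epsilon> * (u \<bullet> (p - p0))" (is ?mean)
    and "measure_pmf.expectation (bit_flip_sample_pmf p \<epsilon>) (\<lambda>z. (u \<bullet> (z - p_tilde \<epsilon> p0))\<^sup>2) =
      (alpha_eps \<epsilon>)\<^sup>2 * (\<Sum>j\<in>UNIV. p $ j * (u $ j - u \<bullet> p0)\<^sup>2)
        + exp (\<epsilon> / 2) / (exp (\<epsilon> / 2) + 1)\<^sup>2 * (u \<bullet> u)" (is ?second)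
proof -
  have ax: "axis j (1::real) $ k \<in> {0, 1}" for j k :: 'd
    by (simp add: axis_def)
  have u: "u \<bullet> (axis j 1 - p0) = u $ j - u \<bullet> p0" for j
    by (simp add: inner_diff_right inner_axis)
  have "(\<Sum>j\<in>UNIV. p $ j * (alpha_eps \<epsilon> * (u $ j - u \<bullet> p0))) =
      alpha_eps \<epsilon> * ((\<Sum>j\<in>UNIV. p $ j * u $ j) - (\<Sum>j\<in>UNIV. p $ j) * (u \<bullet> p0))"
    by (simp add: right_diff_distrib sum_subtractf sum_distrib_left sum_distrib_right mult_ac)
  also have "\<dots> = alpha_eps \<epsilon> * (u \<bullet> (p - p0))"
    by (simp add: p inner_diff_right) (simp add: inner_vec_def mult.commute)
  finally show ?mean
    by (simp add: expectation_bit_flip_sample_pmf[OF p] expectation_bit_flip_pmf_inner[OF ax] u)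
  define c where "c = exp (\<epsilon> / 2) / (exp (\<epsilon> / 2) + 1)\<^sup>2 * (u \<bullet> u)"
  have "(\<Sum>j\<in>UNIV. p $ j * ((alpha_eps \<epsilon> * (u $ j - u \<bullet> p0))\<^sup>2 + c)) =
      (alpha_eps \<epsilon>)\<^sup>2 * (\<Sum>j\<in>UNIV. p $ j * (u $ j - u \<bullet> p0)\<^sup>2) + (\<Sum>j\<in>UNIV. p $ j) * c"
    by (simp add: distrib_left sum.distrib power_mult_distrib sum_distrib_left sum_distrib_right mult_ac)
  then show ?second
    by (simp only: expectation_bit_flip_sample_pmf[OF p] expectation_bit_flip_pmf_inner[OF ax] u p
        c_def[symmetric] mult_1)
qed

section \<open>The covariance matrix as a quadratic form\<close>

lemma inner_diag_matrix: "u \<bullet> (diag_matrix p *v w) = (\<Sum>j\<in>UNIV. p $ j * u $ j * w $ j)"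
proof -
  have "diag_matrix p *v w = (\<chi> j. p $ j * w $ j)"
    by (simp add: vec_eq_iff diag_matrix_def matrix_vector_mult_def if_distrib[of "\<lambda>t. t * _"] cong: if_cong)
  then show ?thesis by (simp add: inner_vec_def mult_ac)
qed

lemma inner_outer_product: "u \<bullet> (outer_product p q *v w) = (u \<bullet> p) * (q \<bullet> w)"
proof -
  have "outer_product p q *v w = (q \<bullet> w) *\<^sub>R p"
    by (simp add: vec_eq_iff outer_product_def matrix_vector_mult_def inner_vec_def
        sum_distrib_left mult_ac)
  then show ?thesis by simp
qed

lemma inner_Sigma_bit:
  "u \<bullet> (Sigma_bit \<epsilon> p *v w) =
    (alpha_eps \<epsilon>)\<^sup>2 * ((\<Sum>j\<in>UNIV. p $ j * u $ j * w $ j) - (u \<bullet> p) * (p \<bullet> w))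
    + exp (\<epsilon> / 2) / (exp (\<epsilon> / 2) + 1)\<^sup>2 * (u \<bullet> w)"
  unfolding Sigma_bit_def
  by (simp add: matrix_vector_mult_add_rdistrib scaleR_matrix_vector_assoc[symmetric]
      matrix_vector_mult_diff_rdistrib inner_add_right inner_diff_right
      inner_diag_matrix inner_outer_product)

text \<open>The multinomial part of \<Sigma>(p) is the variance of the entries of \<open>u\<close>
  under the weights \<open>p\<close>. This form matches the second moment of a record and is visibly
  nonnegative.\<close>

lemma inner_Sigma_bit_self:
  fixes p :: "real ^ 'd"
  assumes "(\<Sum>j\<in>UNIV. p $ j) = 1"
  shows "u \<bullet> (Sigma_bit \<epsilon> p *v u) = (alpha_eps \<epsilon>)\<^sup>2 * (\<Sum>j\<in>UNIV. p $ j * (u $ j - u \<bullet> p)\<^sup>2)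
    + exp (\<epsilon> / 2) / (exp (\<epsilon> / 2) + 1)\<^sup>2 * (u \<bullet> u)"
proof -
  have "(\<Sum>j\<in>UNIV. p $ j * (u $ j - t)\<^sup>2) = (\<Sum>j\<in>UNIV. p $ j * u $ j * u $ j)
     - 2 * t * (\<Sum>j\<in>UNIV. u $ j * p $ j) + (\<Sum>j\<in>UNIV. p $ j) * t\<^sup>2" for t
    unfolding sum_distrib_left sum_distrib_right sum_subtractf[symmetric] sum.distrib[symmetric]
    by (rule sum.cong) (simp_all add: power2_eq_square algebra_simps)
  from this[of "u \<bullet> p"] have "(\<Sum>j\<in>UNIV. p $ j * (u $ j - u \<bullet> p)\<^sup>2) = (\<Sum>j\<in>UNIV. p $ j * u $ j * u $ j)
     - 2 * (u \<bullet> p) * (\<Sum>j\<in>UNIV. u $ j * p $ j) + (\<Sum>j\<in>UNIV. p $ j) * (u \<bullet> p)\<^sup>2" .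
  also have "(\<Sum>j\<in>UNIV. u $ j * p $ j) = u \<bullet> p"
    by (simp add: inner_vec_def)
  finally show ?thesis
    unfolding inner_Sigma_bit by (simp add: assms power2_eq_square inner_commute)
qed

section \<open>Characteristic function of the normalised histogram\<close>

lemma char_private_histogram:
  fixes u p p0 :: "real ^ 'd"
  assumes "n \<ge> 1"
  shows "(CLINT H|private_histogram_pmf n p \<epsilon>.
      iexp (u \<bullet> (sqrt (real n) *\<^sub>R ((1 / real n) *\<^sub>R H - p_tilde \<epsilon> p0)))) =
    (CLINT z|bit_flip_sample_pmf p \<epsilon>. iexp (u \<bullet> (z - p_tilde \<epsilon> p0) / sqrt (real n))) ^ n"
proof -
  let ?q = "bit_flip_sample_pmf p \<epsilon>"
  have n: "sqrt (real n) * sqrt (real n) = real n" "sqrt (real n) > 0" using assms by auto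
  have "u \<bullet> (sqrt (real n) *\<^sub>R ((1 / real n) *\<^sub>R (\<Sum>i\<in>{1..n}. Z i) - p_tilde \<epsilon> p0)) =
      (\<Sum>i\<in>{1..n}. u \<bullet> (Z i - p_tilde \<epsilon> p0) / sqrt (real n))" for Z :: "nat \<Rightarrow> real ^ 'd"
  proof -
    have "(\<Sum>i\<in>{1..n}. u \<bullet> (Z i - p_tilde \<epsilon> p0) / sqrt (real n)) =
        ((\<Sum>i\<in>{1..n}. u \<bullet> Z i) - real n * (u \<bullet> p_tilde \<epsilon> p0)) / sqrt (real n)"
      by (simp add: inner_diff_right sum_subtractf flip: sum_divide_distrib)
    also have "\<dots> = sqrt (real n) * ((1 / real n) * (\<Sum>i\<in>{1..n}. u \<bullet> Z i) - u \<bullet> p_tilde \<epsilon> p0)"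
    proof -
      have "(A - r * r * B) / r = r * (1 / (r * r) * A - B)" if "r > 0" for A B r :: real
        using that by (simp add: field_simps)
      from this[OF n(2)] show ?thesis unfolding n(1) .
    qed
    finally show ?thesis
      by (simp add: inner_diff_right inner_sum_right)
  qed
  then have "(CLINT H|private_histogram_pmf n p \<epsilon>.
      iexp (u \<bullet> (sqrt (real n) *\<^sub>R ((1 / real n) *\<^sub>R H - p_tilde \<epsilon> p0)))) =
     (CLINT Z|Pi_pmf {1..n} 0 (\<lambda>_. ?q). \<Prod>i\<in>{1..n}. iexp (u \<bullet> (Z i - p_tilde \<epsilon> p0) / sqrt (real n)))"
    unfolding private_histogram_pmf_eq integral_map_pmf by (simp only: iexp_sum finite_atLeastAtMost)
  also have "\<dots> = (\<Prod>i\<in>{1..n}. CLINT z|?q. iexp (u \<bullet> (z - p_tilde \<epsilon> p0) / sqrt (real n)))"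
    by (rule CLINT_Pi_pmf_prod[where h = "\<lambda>_ z. iexp (u \<bullet> (z - p_tilde \<epsilon> p0) / sqrt (real n))"])
      (auto simp: finite_set_bit_flip_sample_pmf)
  finally show ?thesis by simp
qed

text \<open>The drift \<Delta> / sqrt n cancels the factor sqrt n, so the scaled mean is eventually
  constant, while the second moment converges because it is continuous in the sampling
  vector.\<close>

lemma char_private_histogram_tendsto:
  fixes u p0 \<Delta> :: "real ^ 'd"
  assumes p0: "\<And>j. p0 $ j > 0" "(\<Sum>j\<in>UNIV. p0 $ j) = 1" and \<Delta>: "(\<Sum>j\<in>UNIV. \<Delta> $ j) = 0"
  shows "(\<lambda>n. CLINT H|private_histogram_pmf n (p0 + (1 / sqrt (real n)) *\<^sub>R \<Delta>) \<epsilon>.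
      iexp (u \<bullet> (sqrt (real n) *\<^sub>R ((1 / real n) *\<^sub>R H - p_tilde \<epsilon> p0)))) \<longlonglongrightarrow>
    iexp (alpha_eps \<epsilon> * (u \<bullet> \<Delta>)) * exp (- (u \<bullet> (Sigma_bit \<epsilon> p0 *v u)) / 2)"
proof -
  define p where "p n = p0 + (1 / sqrt (real n)) *\<^sub>R \<Delta>" for n :: nat
  have lim0: "(\<lambda>n. 1 / sqrt (real n)) \<longlonglongrightarrow> 0"
    using tendsto_inverse_0_at_top[OF filterlim_compose[OF sqrt_at_top filterlim_real_sequentially]]
    by (simp add: inverse_eq_divide)
  have p_lim: "(\<lambda>n. p n $ j) \<longlonglongrightarrow> p0 $ j" for j
    using tendsto_add[OF tendsto_const[of "p0 $ j"] tendsto_mult_left_zero[OF lim0, of "\<Delta> $ j"]]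
    by (simp add: p_def)
  have p_sum: "(\<Sum>j\<in>UNIV. p n $ j) = 1" for n
    using p0(2) \<Delta> by (simp add: p_def sum.distrib flip: sum_divide_distrib)
  \<comment> \<open>Strict positivity of \<open>p0\<close> in finitely many coordinates makes
    \<open>p n\<close> a probability vector for large n; the moment formulas apply only from there
    on.\<close>
  have "\<forall>\<^sub>F n in sequentially. \<forall>j. p n $ j > 0"
    using order_tendstoD(1)[OF p_lim p0(1)] by (simp add: eventually_all_finite)
  then have p_pos: "\<forall>\<^sub>F n in sequentially. (\<forall>j. p n $ j \<ge> 0) \<and> n \<ge> 1"
    using eventually_ge_at_top[of 1] by eventually_elim (auto intro: less_imp_le)
  let ?X = "\<lambda>z. u \<bullet> (z - p_tilde \<epsilon> p0)"
  have "(\<lambda>n. (CLINT z|bit_flip_sample_pmf (p n) \<epsilon>. iexp (?X z / sqrt (real n))) ^ n) \<longlonglongrightarrow>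
    iexp (alpha_eps \<epsilon> * (u \<bullet> \<Delta>)) * exp (- (u \<bullet> (Sigma_bit \<epsilon> p0 *v u)) / 2)"
  proof (rule char_power_tendsto[OF _ set_bit_flip_sample_pmf_subset])
    show "finite ((\<lambda>z. \<chi> j. z j) ` PiE_dflt UNIV 0 (\<lambda>_. {0, 1}) :: (real ^ 'd) set)"
      by (intro finite_imageI finite_PiE_dflt) auto
    have "\<forall>\<^sub>F n in sequentially. alpha_eps \<epsilon> * (u \<bullet> \<Delta>) =
        sqrt (real n) * measure_pmf.expectation (bit_flip_sample_pmf (p n) \<epsilon>) ?X"
      using p_pos
    proof eventually_elim
      case (elim n)
      then show ?case
        by (simp add: expectation_bit_flip_sample_pmf_inner(1) p_sum) (simp add: p_def)
    qed
    then show "(\<lambda>n. sqrt (real n) * measure_pmf.expectation (bit_flip_sample_pmf (p n) \<epsilon>) ?X)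
        \<longlonglongrightarrow> alpha_eps \<epsilon> * (u \<bullet> \<Delta>)"
      by (rule Lim_transform_eventually[OF tendsto_const])
    have "\<forall>\<^sub>F n in sequentially. (alpha_eps \<epsilon>)\<^sup>2 * (\<Sum>j\<in>UNIV. p n $ j * (u $ j - u \<bullet> p0)\<^sup>2)
        + exp (\<epsilon> / 2) / (exp (\<epsilon> / 2) + 1)\<^sup>2 * (u \<bullet> u) =
        measure_pmf.expectation (bit_flip_sample_pmf (p n) \<epsilon>) (\<lambda>z. (?X z)\<^sup>2)"
      using p_pos
    proof eventually_elim
      case (elim n)
      then show ?case
        by (simp add: expectation_bit_flip_sample_pmf_inner(2) p_sum)
    qed
    moreover have "(\<lambda>n. (alpha_eps \<epsilon>)\<^sup>2 * (\<Sum>j\<in>UNIV. p n $ j * (u $ j - u \<bullet> p0)\<^sup>2)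
        + exp (\<epsilon> / 2) / (exp (\<epsilon> / 2) + 1)\<^sup>2 * (u \<bullet> u)) \<longlonglongrightarrow> u \<bullet> (Sigma_bit \<epsilon> p0 *v u)"
      unfolding inner_Sigma_bit_self[OF p0(2)]
      by (intro tendsto_add tendsto_mult tendsto_const tendsto_sum p_lim)
    ultimately show "(\<lambda>n. measure_pmf.expectation (bit_flip_sample_pmf (p n) \<epsilon>) (\<lambda>z. (?X z)\<^sup>2))
        \<longlonglongrightarrow> u \<bullet> (Sigma_bit \<epsilon> p0 *v u)"
      by (rule Lim_transform_eventually[rotated])
  qed
  moreover have "\<forall>\<^sub>F n in sequentially.
    (CLINT z|bit_flip_sample_pmf (p n) \<epsilon>. iexp (?X z / sqrt (real n))) ^ n =
    (CLINT H|private_histogram_pmf n (p n) \<epsilon>.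
      iexp (u \<bullet> (sqrt (real n) *\<^sub>R ((1 / real n) *\<^sub>R H - p_tilde \<epsilon> p0))))"
    using p_pos by eventually_elim (rule char_private_histogram[symmetric], simp)
  ultimately show ?thesis
    unfolding p_def by (rule Lim_transform_eventually)
qed

section \<open>The quadratic form of the statistic\<close>

text \<open>Gram-Schmidt for the inner product given by \<open>S\<close>, started at
  \<open>w\<close>, which itself is not normalised.\<close>

lemma ex_conjugate_family:
  fixes S :: "real ^ 'd ^ 'd"
  assumes sym: "\<And>x y. x \<bullet> (S *v y) = y \<bullet> (S *v x)"
    and pos: "\<And>x. x \<noteq> 0 \<Longrightarrow> x \<bullet> (S *v x) > 0"
    and "w \<noteq> 0" and "k < CARD('d)"
  shows "\<exists>a :: nat \<Rightarrow> real ^ 'd. (\<forall>i<k. w \<bullet> (S *v a i) = 0) \<and>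
    (\<forall>i<k. \<forall>j<k. a i \<bullet> (S *v a j) = (if i = j then 1 else 0)) \<and>
    independent (insert w (a ` {..<k})) \<and> card (insert w (a ` {..<k})) = Suc k"
  using \<open>k < CARD('d)\<close>
proof (induction k)
  case 0
  then show ?case using \<open>w \<noteq> 0\<close> by simp
next
  case (Suc k)
  then obtain a where a: "\<forall>i<k. w \<bullet> (S *v a i) = 0"
    "\<forall>i<k. \<forall>j<k. a i \<bullet> (S *v a j) = (if i = j then 1 else 0)"
    "independent (insert w (a ` {..<k}))" "card (insert w (a ` {..<k})) = Suc k"
    by auto
  define B where "B = insert w (a ` {..<k})"
  \<comment> \<open>The images of the k + 1 vectors found so far cannot span the space, so some
    nonzero \<open>x\<close> is orthogonal to all of them, that is, \<open>S\<close>-conjugate to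
    \<open>B\<close>.\<close>
  have "dim ((*v) S ` B) \<le> card ((*v) S ` B)"
    by (rule dim_le_card') (simp add: B_def)
  also have "\<dots> \<le> card B"
    by (rule card_image_le) (simp add: B_def)
  also have "\<dots> < DIM(real ^ 'd)"
    using a(4) Suc.prems by (simp add: B_def)
  finally obtain x where x: "x \<noteq> 0" "\<And>y. y \<in> span ((*v) S ` B) \<Longrightarrow> orthogonal x y"
    by (rule orthogonal_to_subspace_exists) blast
  have xB: "x \<bullet> (S *v y) = 0" if "y \<in> B" for y
    using x(2)[of "S *v y"] that by (auto simp: orthogonal_def intro: span_base)
  define z where "z = (1 / sqrt (x \<bullet> (S *v x))) *\<^sub>R x"
  have zB: "z \<bullet> (S *v y) = 0" "y \<bullet> (S *v z) = 0" if "y \<in> B" for y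
    using xB[OF that] sym[of y x] by (simp_all add: z_def matrix_vector_mult_scaleR)
  have zz: "z \<bullet> (S *v z) = 1"
    using pos[OF x(1)] by (simp add: z_def matrix_vector_mult_scaleR)
  \<comment> \<open>Everything in the span of \<open>B\<close> is conjugate to \<open>z\<close>, but
    \<open>z\<close> is not conjugate to itself.\<close>
  have "z \<notin> span B"
  proof
    assume "z \<in> span B"
    moreover have "subspace {y. z \<bullet> (S *v y) = 0}"
      by (simp add: subspace_def matrix_vector_right_distrib inner_add_right matrix_vector_mult_scaleR)
    ultimately have "z \<in> {y. z \<bullet> (S *v y) = 0}"
      using zB(1) span_minimal[of B "{y. z \<bullet> (S *v y) = 0}"] by blast
    then show False using zz by simp
  qed
  then have "independent (insert z B)" "z \<notin> B"
    using independent_insertI[of z B] a(3) span_base[of z B] unfolding B_def by blast+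
  define a' where "a' = a(k := z)"
  have "insert w (a' ` {..<Suc k}) = insert z B"
    by (auto simp: a'_def B_def lessThan_Suc)
  moreover have "a' i = a i" if "i < k" for i using that by (simp add: a'_def)
  moreover have "a' k = z" by (simp add: a'_def)
  moreover have "w \<in> B" "\<And>i. i < k \<Longrightarrow> a i \<in> B" by (auto simp: B_def)
  moreover have "card (insert z B) = Suc (Suc k)"
    using a(4) \<open>z \<notin> B\<close> by (simp add: B_def)
  ultimately show ?case
    using a(1,2) zB zz \<open>independent (insert z B)\<close>
    by (intro exI[of _ a']) (auto simp: less_Suc_eq)
qed

section \<open>Centring, inversion and whitening\<close>

lemma matrix_mult_inv_right:
  fixes A :: "real ^ 'd ^ 'd"
  assumes "invertible A"
  shows "A ** matrix_inv A = mat 1"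
  using assms someI_ex[of "\<lambda>B. A ** B = mat 1 \<and> B ** A = mat 1"]
  unfolding invertible_def matrix_inv_def by blast

lemma centering_matrix_mult:
  fixes x :: "real ^ 'd"
  shows "centering_matrix *v x = x - ((1 \<bullet> x) / real CARD('d)) *\<^sub>R 1"
proof -
  have "outer_product 1 1 *v x = (1 \<bullet> x) *\<^sub>R 1"
    by (simp add: vec_eq_iff outer_product_def matrix_vector_mult_def inner_vec_def)
  then show ?thesis
    by (simp add: centering_matrix_def matrix_vector_mult_diff_rdistrib
        scaleR_matrix_vector_assoc[symmetric])
qed

lemma inner_one_one: "(1 :: real ^ 'd) \<bullet> 1 = real CARD('d)"
  by (simp add: inner_vec_def)

lemma inner_one: "(1 :: real ^ 'd) \<bullet> x = (\<Sum>j\<in>UNIV. x $ j)"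
  by (simp add: inner_vec_def)

lemma inner_one_centering: "1 \<bullet> (centering_matrix *v x) = 0"
  by (simp add: centering_matrix_mult inner_diff_right inner_one_one)

lemma inner_centering: "x \<bullet> (centering_matrix *v y) = (centering_matrix *v x) \<bullet> y"
  by (simp add: centering_matrix_mult inner_diff_right inner_diff_left inner_commute)

context
  fixes \<epsilon> :: real and p :: "real ^ 'd"
  assumes p: "\<And>j. p $ j \<ge> 0" "(\<Sum>j\<in>UNIV. p $ j) = 1"
begin

lemma Sigma_bit_sym: "x \<bullet> (Sigma_bit \<epsilon> p *v y) = y \<bullet> (Sigma_bit \<epsilon> p *v x)"
  unfolding inner_Sigma_bit by (simp add: inner_commute mult_ac)

lemma Sigma_bit_pos:
  assumes "x \<noteq> 0"
  shows "x \<bullet> (Sigma_bit \<epsilon> p *v x) > 0"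
proof -
  have "exp (\<epsilon> / 2) + 1 > 0" by (simp add: add_pos_pos)
  then have "exp (\<epsilon> / 2) / (exp (\<epsilon> / 2) + 1)\<^sup>2 * (x \<bullet> x) > 0"
    using assms by (intro mult_pos_pos divide_pos_pos) auto
  moreover have "(\<Sum>j\<in>UNIV. p $ j * (x $ j - x \<bullet> p)\<^sup>2) \<ge> 0"
    using p by (intro sum_nonneg) auto
  ultimately show ?thesis
    unfolding inner_Sigma_bit_self[OF p(2)] by (simp add: add_nonneg_pos)
qed

text \<open>Both Diag(p) and p p^T send the all-ones vector to \<open>p\<close>, because
  \<open>p\<close> sums to 1; only the multiple of the identity survives.\<close>

lemma Sigma_bit_one: "x \<bullet> (Sigma_bit \<epsilon> p *v 1) = exp (\<epsilon> / 2) / (exp (\<epsilon> / 2) + 1)\<^sup>2 * (x \<bullet> 1)"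
proof -
  have "(\<Sum>j\<in>UNIV. p $ j * x $ j) = x \<bullet> p"
    by (simp add: inner_vec_def mult.commute)
  then show ?thesis
    unfolding inner_Sigma_bit using p(2) by (simp add: inner_commute[of p] inner_one)
qed

lemma Sigma_bit_inverse: "Sigma_bit \<epsilon> p *v (matrix_inv (Sigma_bit \<epsilon> p) *v x) = x"
proof -
  have "x = 0" if "Sigma_bit \<epsilon> p *v x = 0" for x
    using Sigma_bit_pos[of x] that by auto
  then have "invertible (Sigma_bit \<epsilon> p)"
    unfolding invertible_left_inverse matrix_left_invertible_ker by blast
  then show ?thesis
    by (simp add: matrix_vector_mul_assoc matrix_mult_inv_right)
qed

text \<open>
  The vectors \<open>a i\<close> form a \<open>\<Sigma>\<close>-orthonormal basis of the orthogonal complement of \<open>1\<close>, which \<open>\<Sigma>\<close>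
  leaves invariant because \<open>1\<close> is an eigenvector.
\<close>

lemma ex_whitening_family:
  obtains a :: "nat \<Rightarrow> real ^ 'd" where
    "\<And>i j. i < CARD('d) - 1 \<Longrightarrow> j < CARD('d) - 1 \<Longrightarrow>
      a i \<bullet> (Sigma_bit \<epsilon> p *v a j) = (if i = j then 1 else 0)"
    "\<And>v. v \<bullet> ((centering_matrix ** matrix_inv (Sigma_bit \<epsilon> p) ** centering_matrix) *v v) =
      (\<Sum>i<CARD('d) - 1. (a i \<bullet> v)\<^sup>2)"
proof -
  let ?\<nu> = "CARD('d) - 1" and ?S = "Sigma_bit \<epsilon> p"
  have "(1 :: real ^ 'd) \<noteq> 0" by (simp add: vec_eq_iff)
  moreover have "?\<nu> < CARD('d)" by simp
  ultimately obtain a :: "nat \<Rightarrow> real ^ 'd" where a: "\<And>i. i < ?\<nu> \<Longrightarrow> 1 \<bullet> (?S *v a i) = 0"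
    "\<And>i j. i < ?\<nu> \<Longrightarrow> j < ?\<nu> \<Longrightarrow> a i \<bullet> (?S *v a j) = (if i = j then 1 else 0)"
    "independent (insert 1 (a ` {..<?\<nu>}))" "card (insert 1 (a ` {..<?\<nu>})) = Suc ?\<nu>"
    using ex_conjugate_family[of ?S 1 ?\<nu>, OF Sigma_bit_sym Sigma_bit_pos] by blast
  have c: "exp (\<epsilon> / 2) / (exp (\<epsilon> / 2) + 1)\<^sup>2 \<noteq> 0"
    by (simp add: add_pos_pos less_imp_neq[symmetric])
  have a1: "a i \<bullet> 1 = 0" if "i < ?\<nu>" for i
    using a(1)[OF that] Sigma_bit_sym[of 1 "a i"] Sigma_bit_one[of "a i"] c by simp
  \<comment> \<open>There are d independent vectors: the d - 1 conjugate ones together with the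
    all-ones vector.\<close>
  have span: "span (insert 1 (a ` {..<?\<nu>})) = UNIV"
    using card_ge_dim_independent[OF subset_UNIV a(3)] a(4) by auto
  show ?thesis
  proof (rule that[OF a(2)])
    fix v :: "real ^ 'd"
    \<comment> \<open>The quadratic form is \<open>v \<bullet> u\<close>, and \<open>y\<close> is
      the expected expansion of \<open>u\<close> in the conjugate family. Testing
      \<open>?S *v (u - y)\<close> against the basis shows u = y.\<close>
    define u where "u = centering_matrix *v (matrix_inv ?S *v (centering_matrix *v v))"
    define y where "y = (\<Sum>i<?\<nu>. (a i \<bullet> v) *\<^sub>R a i)"
    have Sy: "t \<bullet> (?S *v y) = (\<Sum>i<?\<nu>. (a i \<bullet> v) * (t \<bullet> (?S *v a i)))" for t
      by (simp add: y_def linear_sum[OF matrix_vector_mul_linear] inner_sum_right matrix_vector_mult_scaleR)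
    have "t \<bullet> (?S *v (u - y)) = 0" if t: "t \<in> insert 1 (a ` {..<?\<nu>})" for t
    proof (cases "t = 1")
      case True
      have "1 \<bullet> (?S *v u) = 0"
        using Sigma_bit_sym[of 1 u] Sigma_bit_one[of u]
        by (simp add: u_def inner_commute[of _ 1] inner_one_centering)
      then show ?thesis
        using a(1) by (simp add: True matrix_vector_mult_diff_distrib inner_diff_right Sy)
    next
      case False
      then obtain j where j: "j < ?\<nu>" "t = a j" using t by blast
      have S1: "a j \<bullet> (?S *v 1) = 0"
        using Sigma_bit_one[of "a j"] a1[OF j(1)] by simp
      \<comment> \<open>The outer centring changes its argument by a multiple of the all-ones
        vector, to which \<open>a j\<close> is conjugate; then \<open>?S\<close> cancels its
        inverse.\<close>
      have "a j \<bullet> (?S *v u) = a j \<bullet> (centering_matrix *v v)"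
        unfolding u_def centering_matrix_mult[of "matrix_inv ?S *v _"]
        by (simp add: matrix_vector_mult_diff_distrib inner_diff_right matrix_vector_mult_scaleR
            S1 Sigma_bit_inverse)
      also have "\<dots> = a j \<bullet> v"
        using a1[OF j(1)] by (simp add: centering_matrix_mult inner_diff_right)
      finally have "a j \<bullet> (?S *v u) = a j \<bullet> v" .
      moreover have "a j \<bullet> (?S *v y) = (\<Sum>i<?\<nu>. if j = i then a i \<bullet> v else 0)"
        unfolding Sy using a(2)[OF j(1)] by (intro sum.cong) auto
      ultimately show ?thesis
        using j by (simp add: matrix_vector_mult_diff_distrib inner_diff_right)
    qed
    moreover have "subspace {t. t \<bullet> (?S *v (u - y)) = 0}"
      by (simp add: subspace_def inner_add_left)
    ultimately have "span (insert 1 (a ` {..<?\<nu>})) \<subseteq> {t. t \<bullet> (?S *v (u - y)) = 0}"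
      by (intro span_minimal) auto
    then have "(u - y) \<bullet> (?S *v (u - y)) = 0"
      unfolding span by blast
    then have "u = y"
      using Sigma_bit_pos[of "u - y"] by fastforce
    then have "v \<bullet> u = (\<Sum>i<?\<nu>. (a i \<bullet> v)\<^sup>2)"
      by (simp add: y_def inner_sum_right power2_eq_square inner_commute)
    then show "v \<bullet> ((centering_matrix ** matrix_inv ?S ** centering_matrix) *v v) = (\<Sum>i<?\<nu>. (a i \<bullet> v)\<^sup>2)"
      by (simp add: u_def matrix_vector_mul_assoc matrix_mul_assoc)
  qed
qed

end

section \<open>The limit law of the statistic\<close>

text \<open>Writing the noncentrality as a sum of squares supplies the witness for the choice
  operator, also when \<nu> = 0.\<close>

lemma noncentral_chi_squareE:
  obtains \<mu> where "noncentral_chi_square \<nu> (\<Sum>i<\<nu>. (m i)\<^sup>2) = norm2_normal_law \<nu> \<mu>"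
    "(\<Sum>i<\<nu>. (\<mu> i)\<^sup>2) = (\<Sum>i<\<nu>. (m i)\<^sup>2)"
  using someI[of "\<lambda>\<mu>. (\<Sum>i<\<nu>. (\<mu> i)\<^sup>2) = (\<Sum>i<\<nu>. (m i)\<^sup>2)" m]
  unfolding noncentral_chi_square_def by blast

lemma T_BitFlip_law_weak_conv:
  fixes p0 \<Delta> :: "real ^ 'd"
  assumes p0: "\<And>j. p0 $ j > 0" "(\<Sum>j\<in>UNIV. p0 $ j) = 1" and \<Delta>: "(\<Sum>j\<in>UNIV. \<Delta> $ j) = 0"
  shows "weak_conv_m (\<lambda>n. T_BitFlip_law n \<epsilon> p0 (p0 + (1 / sqrt (real n)) *\<^sub>R \<Delta>))
    (noncentral_chi_square (CARD('d) - 1)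
      ((alpha_eps \<epsilon>)\<^sup>2 * (\<Delta> \<bullet> (matrix_inv (Sigma_bit \<epsilon> p0) *v \<Delta>))))"
proof -
  let ?\<nu> = "CARD('d) - 1" and ?S = "Sigma_bit \<epsilon> p0"
  obtain a :: "nat \<Rightarrow> real ^ 'd" where
    a: "\<And>i j. i < ?\<nu> \<Longrightarrow> j < ?\<nu> \<Longrightarrow> a i \<bullet> (?S *v a j) = (if i = j then 1 else 0)"
    and quad: "\<And>v. v \<bullet> ((centering_matrix ** matrix_inv ?S ** centering_matrix) *v v) =
      (\<Sum>i<?\<nu>. (a i \<bullet> v)\<^sup>2)"
    using ex_whitening_family[OF less_imp_le[OF p0(1)] p0(2)] by blast
  define m where "m i = alpha_eps \<epsilon> * (a i \<bullet> \<Delta>)" for i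
  define Y where "Y n H i = a i \<bullet> (sqrt (real n) *\<^sub>R ((1 / real n) *\<^sub>R H - p_tilde \<epsilon> p0))"
    for n :: nat and H :: "real ^ 'd" and i
  \<comment> \<open>As \<Delta> is already centred, the whitening identity at \<Delta> expresses the
    noncentrality through the limiting means \<open>m i\<close>.\<close>
  have "centering_matrix *v \<Delta> = \<Delta>"
    using \<Delta> by (simp add: centering_matrix_mult inner_one)
  then have "\<Delta> \<bullet> (matrix_inv ?S *v \<Delta>) = (\<Sum>i<?\<nu>. (a i \<bullet> \<Delta>)\<^sup>2)"
    using quad[of \<Delta>] inner_centering[of \<Delta> "matrix_inv ?S *v \<Delta>"]
    by (simp add: matrix_vector_mul_assoc[symmetric])
  then have l: "(alpha_eps \<epsilon>)\<^sup>2 * (\<Delta> \<bullet> (matrix_inv ?S *v \<Delta>)) = (\<Sum>i<?\<nu>. (m i)\<^sup>2)"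
    by (simp add: m_def power_mult_distrib sum_distrib_left)
  have T: "T_BitFlip n \<epsilon> p0 = (\<lambda>H. \<Sum>i<?\<nu>. (Y n H i)\<^sup>2)" for n
    by (simp add: fun_eq_iff T_BitFlip_def Let_def quad Y_def power_mult_distrib sum_distrib_left)
  obtain \<mu> where \<mu>: "noncentral_chi_square ?\<nu> (\<Sum>i<?\<nu>. (m i)\<^sup>2) = norm2_normal_law ?\<nu> \<mu>"
    "(\<Sum>i<?\<nu>. (\<mu> i)\<^sup>2) = (\<Sum>i<?\<nu>. (m i)\<^sup>2)"
    by (rule noncentral_chi_squareE)
  show ?thesis
    unfolding T_BitFlip_law_def T l \<mu>(1)
  proof (rule weak_conv_m_sum_squares_normal[OF finite_set_private_histogram_pmf _ \<mu>(2)[symmetric]])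
    fix g :: "nat \<Rightarrow> real"
    \<comment> \<open>Collects the frequencies \<open>g\<close> into one direction; conjugacy of the
      \<open>a i\<close> turns its \<Sigma>-norm into the Euclidean norm of
      \<open>g\<close>.\<close>
    define u where "u = (\<Sum>i<?\<nu>. g i *\<^sub>R a i)"
    have "(\<Sum>i<?\<nu>. g i * Y n H i) =
        u \<bullet> (sqrt (real n) *\<^sub>R ((1 / real n) *\<^sub>R H - p_tilde \<epsilon> p0))" for n H
      by (simp add: u_def Y_def inner_sum_left del: inner_scaleR_right)
    moreover have "(\<Sum>i<?\<nu>. g i * m i) = alpha_eps \<epsilon> * (u \<bullet> \<Delta>)"
      by (simp add: u_def m_def inner_sum_left sum_distrib_left mult_ac)
    moreover have "u \<bullet> (?S *v u) = (\<Sum>i<?\<nu>. (g i)\<^sup>2)"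
    proof -
      have "u \<bullet> (?S *v u) = (\<Sum>j<?\<nu>. \<Sum>i<?\<nu>. g j * (g i * (a i \<bullet> (?S *v a j))))"
        by (simp add: u_def inner_sum_left inner_sum_right linear_sum[OF matrix_vector_mul_linear]
            matrix_vector_mult_scaleR sum_distrib_left)
      also have "\<dots> = (\<Sum>j<?\<nu>. \<Sum>i<?\<nu>. if i = j then (g i)\<^sup>2 else 0)"
        by (intro sum.cong) (auto simp: a power2_eq_square)
      finally show ?thesis by simp
    qed
    ultimately show "(\<lambda>n. CLINT H|private_histogram_pmf n (p0 + (1 / sqrt (real n)) *\<^sub>R \<Delta>) \<epsilon>.
        iexp (\<Sum>i<?\<nu>. g i * Y n H i)) \<longlonglongrightarrow> iexp (\<Sum>i<?\<nu>. g i * m i) * exp (- (\<Sum>i<?\<nu>. (g i)\<^sup>2) / 2)"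
      using char_private_histogram_tendsto[OF p0 \<Delta>, of \<epsilon> u] by (simp only:)
  qed
qed

theorem theorem5p9:
  fixes \<epsilon> :: real and p0 :: "real ^ 'd"
  assumes "\<epsilon> > 0"
    and "\<And>j. p0 $ j > 0"
    and "(\<Sum>j\<in>UNIV. p0 $ j) = 1"
  shows "weak_conv_m (\<lambda>n. T_BitFlip_law n \<epsilon> p0 p0) (chi_square (CARD('d) - 1)) \<and>
    (\<forall>\<Delta> :: real ^ 'd. (\<Sum>j\<in>UNIV. \<Delta> $ j) = 0 \<longrightarrow>
      weak_conv_m
        (\<lambda>n. T_BitFlip_law n \<epsilon> p0 (p0 + (1 / sqrt (real n)) *\<^sub>R \<Delta>))
        (noncentral_chi_square (CARD('d) - 1)
          (((exp (\<epsilon> / 2) - 1) / (exp (\<epsilon> / 2) + 1))\<^sup>2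
             * (\<Delta> \<bullet> (matrix_inv (Sigma_bit \<epsilon> p0) *v \<Delta>)))))"
proof (intro conjI allI impI)
  show "weak_conv_m (\<lambda>n. T_BitFlip_law n \<epsilon> p0 p0) (chi_square (CARD('d) - 1))"
    \<comment> \<open>The null hypothesis is the case \<Delta> = 0, where the noncentrality
      vanishes.\<close>
    using T_BitFlip_law_weak_conv[OF assms(2,3), of 0 \<epsilon>] by (simp add: chi_square_def)
next
  fix \<Delta> :: "real ^ 'd"
  assume "(\<Sum>j\<in>UNIV. \<Delta> $ j) = 0"
  then show "weak_conv_m
        (\<lambda>n. T_BitFlip_law n \<epsilon> p0 (p0 + (1 / sqrt (real n)) *\<^sub>R \<Delta>))
        (noncentral_chi_square (CARD('d) - 1)
          (((exp (\<epsilon> / 2) - 1) / (exp (\<epsilon> / 2) + 1))\<^sup>2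
             * (\<Delta> \<bullet> (matrix_inv (Sigma_bit \<epsilon> p0) *v \<Delta>))))"
    using T_BitFlip_law_weak_conv[OF assms(2,3)] unfolding alpha_eps_def by blast
qed

end
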